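(* Let $f\colon\mathbb R^n\times\mathbb R^m\to\overline{\mathbb R}$ be proper and lower semicontinuous, let $\bar x\in\mathbb R^n$ satisfy $0\in\partial_x f(\bar x,0)$, and let $M$, $M_1$, $Y$, $\widehat Y(\bar x)$ be the associated objects defined in the context. Assume that properties (A) and (B) from the context hold (which is in particular the case if $f$ is of the composite form described in the context). (1) If the mapping $M$ is isolatedly calm at $((0,0),\bar x)$, then for each $\bar y\in\widehat Y(\bar x)$ and all $d^x\in\mathbb R^n$, $d^y\in\mathbb R^m$, $$((0,0),(d^x,d^y))\in T_{\operatorname{gph}M_1}((0,0),(\bar x,\bar y))\quad\Longrightarrow\quad d^x=0,$$ and $Y$ is inner calm* in the fuzzy sense w.r.t. $\operatorname{dom}Y$ at $(0,0,\bar x)$ in each direction $(0,0,d^x)$ with $d^x\neq 0$. The converse implication holds if, additionally, properties (C) and (D) from the context hold (which is in particular the case if $f$ is of the composite form and the qualification condition (BQ) from the context holds). (2) If the mapping $M$ is isolatedly calm around $((0,0),\bar x)$, then for each $\bar y\in\widehat Y(\bar x)$ and all $d^x\in\mathbb R^n$, $d^y\in\mathbb R^m$, $$((0,0),(d^x,d^y))\in T^{\#}_{\operatorname{gph}M_1}((0,0),(\bar x,\bar y))\quad\Longrightarrow\quad d^x=0,$$ and $Y$ is locally uniformly inner calm* in the fuzzy sense w.r.t. $\operatorname{dom}Y$ at $(0,0,\bar x)$ in each direction $(0,0,d^x)$ with $d^x\neq 0$. The converse implication holds if, additionally, properties (C) and (D) hold (in particular if $f$ is of the composite form and (BQ) 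holds).
   Context: Subdifferentials. For proper lower semicontinuous $h\colon\mathbb R^k\to\overline{\mathbb R}$ and $z\in\operatorname{dom}h$, $\partial h(z):=\{\zeta\mid(\zeta,-1)\in N_{\operatorname{epi}h}(z,h(z))\}$ and $\partial^\infty h(z):=\{\zeta\mid(\zeta,0)\in N_{\operatorname{epi}h}(z,h(z))\}$ are the limiting and singular subdifferential ($N$ is the limiting normal cone); subdifferentials are empty outside $\operatorname{dom}h$. $\partial_xf(x,u)$ is the limiting subdifferential of $f(\cdot,u)$ at $x$. Mappings. For $(v,u,x)\in\mathbb R^n\times\mathbb R^m\times\mathbb R^n$: $M(v,u):=\{x\mid v\in\partial_xf(x,u)\}$, $M_1(v,u):=\{(x,y)\mid(v,y)\in\partial f(x,u)\}$, $Y(v,u,x):=\{y\mid(v,y)\in\partial f(x,u)\}$, and $\widehat Y(\bar x):=Y(0,0,\bar x)$. For a set-valued mapping $\Upsilon$, $\operatorname{dom}\Upsilon=\{x\mid\Upsilon(x)\ne\emptyset\}$, $\operatorname{gph}\Upsilon=\{(x,y)\mid y\in\Upsilon(x)\}$. Properties. (A) For every $(v,u,x)\in\operatorname{dom}Y$ we have $v\in\partial_xf(x,u)$ and $Y(v,u,x)$ is convex. (B) $\operatorname{gph}Y$ is closed. Properties (C) and (D): there is a closed neighborhood $W$ of $(0,0,\bar x)$ such that (C) $W\cap\operatorname{dom}Y$ is closed, for all $(v,u,x)\in W$ one has $v\in\partial_xf(x,u)\iff\exists y\colon(v,y)\in\partial f(x,u)\iff(v,u,x)\in\operatorname{dom}Y$,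 and (in particular) $\operatorname{gph}\partial_xf$ is closed locally around $((\bar x,0),0)$; (D) the set $Y(W)=\bigcup_{w\in W}Y(w)$ is bounded. Composite form: $f(x,u)=f_0(x)+g(F(x)+u)$ with $f_0\colon\mathbb R^n\to\mathbb R$, $F\colon\mathbb R^n\to\mathbb R^m$ twice continuously differentiable and $g\colon\mathbb R^m\to\overline{\mathbb R}$ proper, lower semicontinuous, convex. (BQ): $F'(\bar x)^\top y=0,\ y\in\partial^\infty g(F(\bar x))\Rightarrow y=0$. Tangent cones. For a set $C$ and $z\in C$: $T_C(z):=\{d\mid\exists d_k\to d,\,t_k\downarrow0\colon z+t_kd_k\in C\ \forall k\}$ and $T^{\#}_C(z):=\{d\mid\exists z_k\to z,\,d_k\to d\colon z_k\in C,\,d_k\in T_C(z_k)\ \forall k\}$. Isolated calmness. A set-valued mapping $\Upsilon\colon\mathbb R^p\rightrightarrows\mathbb R^q$ is isolatedly calm at $(\bar a,\bar b)\in\operatorname{gph}\Upsilon$ with constant $\kappa>0$ if there is a neighborhood $V$ of $\bar b$ with $\|b-\bar b\|\le\kappa\|a-\bar a\|$ for all $a\in\mathbb R^p$, $b\in\Upsilon(a)\cap V$; isolatedly calm at $(\bar a,\bar b)$ if this holds for some $\kappa$; isolatedly calm around $(\bar a,\bar b)$ if there are $\kappa>0$ and a neighborhood $\mathcal W$ of $(\bar a,\bar b)$ such that $\Upsilon$ is isolatedly calm with constant $\kappa$ at every point of $\mathcal W\cap\operatorname{gph}\Upsilon$. Inner calmness*. $\Upsilon\colon\mathbb R^p\rightrightarrows\mathbb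 R^q$ is inner calm* in the fuzzy sense w.r.t. $\operatorname{dom}\Upsilon$ at $\bar a\in\operatorname{dom}\Upsilon$ in direction $d$ if either $d\notin T_{\operatorname{dom}\Upsilon}(\bar a)$, or there are $\kappa_d>0$, $\bar b\in\mathbb R^q$ and sequences $d_k\to d$, $t_k\downarrow0$, $b_k\to\bar b$ with $\bar a+t_kd_k\in\operatorname{dom}\Upsilon$, $b_k\in\Upsilon(\bar a+t_kd_k)$, $\|b_k-\bar b\|\le\kappa_dt_k\|d_k\|$ for all $k$. The infimum of such $\kappa_d$ is the modulus (it is $0$ if $d\notin T_{\operatorname{dom}\Upsilon}(\bar a)$). $\Upsilon$ is locally uniformly inner calm* in the fuzzy sense w.r.t. $\operatorname{dom}\Upsilon$ at $\bar a$ in direction $d$ if there are neighborhoods $U$ of $\bar a$ and $N$ of $d$ and $\kappa>0$ such that $\Upsilon$ is inner calm* in the fuzzy sense w.r.t. $\operatorname{dom}\Upsilon$ at each $a\in U\cap\operatorname{dom}\Upsilon$ in each direction $d'\in N$ with modulus not larger than $\kappa$. *)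

theory Defs
  imports "HOL-Analysis.Analysis"
begin

section \<open>Extended-real-valued functions\<close>

definition proper_fun :: "('a \<Rightarrow> ereal) \<Rightarrow> bool" where
  "proper_fun h \<longleftrightarrow> (\<forall>z. h z \<noteq> -\<infinity>) \<and> (\<exists>z. h z \<noteq> \<infinity>)"

definition lower_semicont :: "('a::euclidean_space \<Rightarrow> ereal) \<Rightarrow> bool" where
  "lower_semicont h \<longleftrightarrow> (\<forall>z. h z \<le> Liminf (at z) h)"

definition epi :: "('a \<Rightarrow> ereal) \<Rightarrow> ('a \<times> real) set" where
  "epi h = {(z, r). h z \<le> ereal r}"

definition convex_fun :: "('a::real_vector \<Rightarrow> ereal) \<Rightarrow> bool" where
  "convex_fun h \<longleftrightarrow> convex (epi h)"

section \<open>Normal and tangent cones\<close>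

definition regular_normal_cone :: "'a::euclidean_space set \<Rightarrow> 'a \<Rightarrow> 'a set" where
  "regular_normal_cone C z =
     {\<zeta>. z \<in> C \<and>
          (\<forall>\<epsilon>>0. \<exists>\<delta>>0. \<forall>z'\<in>C. norm (z' - z) < \<delta> \<longrightarrow> \<zeta> \<bullet> (z' - z) \<le> \<epsilon> * norm (z' - z))}"

definition limiting_normal_cone :: "'a::euclidean_space set \<Rightarrow> 'a \<Rightarrow> 'a set" where
  "limiting_normal_cone C z =
     {\<zeta>. z \<in> C \<and>
          (\<exists>zk \<zeta>k. zk \<longlonglongrightarrow> z \<and> \<zeta>k \<longlonglongrightarrow> \<zeta> \<and>
             (\<forall>k::nat. zk k \<in> C \<and> \<zeta>k k \<in> regular_normal_cone C (zk k)))}"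

text \<open>
  Here and below, \<open>t\<^sub>k \<down> 0\<close> is read as \<open>t\<^sub>k > 0\<close> and \<open>t\<^sub>k \<rightarrow> 0\<close>, the usual convention in
  variational analysis. The formula for the tangent cone is used at every point \<open>z\<close>, including
  \<open>z \<notin> C\<close>.
\<close>

definition tangent_cone :: "'a::euclidean_space set \<Rightarrow> 'a \<Rightarrow> 'a set" where
  "tangent_cone C z =
     {d. \<exists>dk t. dk \<longlonglongrightarrow> d \<and> t \<longlonglongrightarrow> 0 \<and> (\<forall>k::nat. 0 < t k \<and> z + t k *\<^sub>R dk k \<in> C)}"

definition limiting_tangent_cone :: "'a::euclidean_space set \<Rightarrow> 'a \<Rightarrow> 'a set" where
  "limiting_tangent_cone C z =
     {d. \<exists>zk dk. zk \<longlonglongrightarrow> z \<and> dk \<longlonglongrightarrow> d \<and>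
           (\<forall>k::nat. zk k \<in> C \<and> dk k \<in> tangent_cone C (zk k))}"

section \<open>Subdifferentials\<close>

definition lim_subdiff :: "('a::euclidean_space \<Rightarrow> ereal) \<Rightarrow> 'a \<Rightarrow> 'a set" where
  "lim_subdiff h z =
     {\<zeta>. \<bar>h z\<bar> \<noteq> \<infinity> \<and> (\<zeta>, -1) \<in> limiting_normal_cone (epi h) (z, real_of_ereal (h z))}"

definition sing_subdiff :: "('a::euclidean_space \<Rightarrow> ereal) \<Rightarrow> 'a \<Rightarrow> 'a set" where
  "sing_subdiff h z =
     {\<zeta>. \<bar>h z\<bar> \<noteq> \<infinity> \<and> (\<zeta>, 0) \<in> limiting_normal_cone (epi h) (z, real_of_ereal (h z))}"

definition subdiff_x ::
  "('a::euclidean_space \<times> 'b::euclidean_space \<Rightarrow> ereal) \<Rightarrow> 'a \<Rightarrow> 'b \<Rightarrow> 'a set" where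
  "subdiff_x f x u = lim_subdiff (\<lambda>x'. f (x', u)) x"

section \<open>Set-valued mappings\<close>

definition sv_dom :: "('a \<Rightarrow> 'b set) \<Rightarrow> 'a set" where
  "sv_dom \<Upsilon> = {x. \<Upsilon> x \<noteq> {}}"

definition sv_gph :: "('a \<Rightarrow> 'b set) \<Rightarrow> ('a \<times> 'b) set" where
  "sv_gph \<Upsilon> = {(x, y). y \<in> \<Upsilon> x}"

definition map_M ::
  "('a::euclidean_space \<times> 'b::euclidean_space \<Rightarrow> ereal) \<Rightarrow> 'a \<times> 'b \<Rightarrow> 'a set" where
  "map_M f = (\<lambda>(v, u). {x. v \<in> subdiff_x f x u})"

definition map_M1 ::
  "('a::euclidean_space \<times> 'b::euclidean_space \<Rightarrow> ereal) \<Rightarrow> 'a \<times> 'b \<Rightarrow> ('a \<times> 'b) set" where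
  "map_M1 f = (\<lambda>(v, u). {(x, y). (v, y) \<in> lim_subdiff f (x, u)})"

definition map_Y ::
  "('a::euclidean_space \<times> 'b::euclidean_space \<Rightarrow> ereal) \<Rightarrow> 'a \<times> 'b \<times> 'a \<Rightarrow> 'b set" where
  "map_Y f = (\<lambda>(v, u, x). {y. (v, y) \<in> lim_subdiff f (x, u)})"

definition Y_hat ::
  "('a::euclidean_space \<times> 'b::euclidean_space \<Rightarrow> ereal) \<Rightarrow> 'a \<Rightarrow> 'b set" where
  "Y_hat f x = map_Y f (0, 0, x)"

definition isolatedly_calm_const ::
  "('a::euclidean_space \<Rightarrow> 'b::euclidean_space set) \<Rightarrow> 'a \<Rightarrow> 'b \<Rightarrow> real \<Rightarrow> bool" where
  "isolatedly_calm_const \<Upsilon> a b \<kappa> \<longleftrightarrow>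
     (a, b) \<in> sv_gph \<Upsilon> \<and> \<kappa> > 0 \<and>
     (\<exists>V. b \<in> interior V \<and> (\<forall>a'. \<forall>b'\<in>\<Upsilon> a' \<inter> V. norm (b' - b) \<le> \<kappa> * norm (a' - a)))"

definition isolatedly_calm_at ::
  "('a::euclidean_space \<Rightarrow> 'b::euclidean_space set) \<Rightarrow> 'a \<Rightarrow> 'b \<Rightarrow> bool" where
  "isolatedly_calm_at \<Upsilon> a b \<longleftrightarrow> (\<exists>\<kappa>. isolatedly_calm_const \<Upsilon> a b \<kappa>)"

definition isolatedly_calm_around ::
  "('a::euclidean_space \<Rightarrow> 'b::euclidean_space set) \<Rightarrow> 'a \<Rightarrow> 'b \<Rightarrow> bool" where
  "isolatedly_calm_around \<Upsilon> a b \<longleftrightarrow>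
     (a, b) \<in> sv_gph \<Upsilon> \<and>
     (\<exists>\<kappa>>0. \<exists>W. (a, b) \<in> interior W \<and>
        (\<forall>(a', b') \<in> W \<inter> sv_gph \<Upsilon>. isolatedly_calm_const \<Upsilon> a' b' \<kappa>))"

text \<open>
  The notions below are inner calmness* in the fuzzy sense with respect to \<open>sv_dom \<Upsilon>\<close>.
  Membership \<open>a \<in> sv_dom \<Upsilon>\<close> of the reference point is not built into \<open>inner_calm_star\<close>, so that
  at a point outside the domain the first alternative (the direction is not tangent) can still hold.
\<close>

definition inner_calm_star_const ::
  "('a::euclidean_space \<Rightarrow> 'b::euclidean_space set) \<Rightarrow> 'a \<Rightarrow> 'a \<Rightarrow> real \<Rightarrow> bool" where
  "inner_calm_star_const \<Upsilon> a d \<kappa> \<longleftrightarrow>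
     \<kappa> > 0 \<and>
     (\<exists>b dk t bk. dk \<longlonglongrightarrow> d \<and> t \<longlonglongrightarrow> 0 \<and> bk \<longlonglongrightarrow> b \<and>
        (\<forall>k::nat. 0 < t k \<and> a + t k *\<^sub>R dk k \<in> sv_dom \<Upsilon> \<and>
                  bk k \<in> \<Upsilon> (a + t k *\<^sub>R dk k) \<and>
                  norm (bk k - b) \<le> \<kappa> * t k * norm (dk k)))"

definition inner_calm_star ::
  "('a::euclidean_space \<Rightarrow> 'b::euclidean_space set) \<Rightarrow> 'a \<Rightarrow> 'a \<Rightarrow> bool" where
  "inner_calm_star \<Upsilon> a d \<longleftrightarrow>
     d \<notin> tangent_cone (sv_dom \<Upsilon>) a \<or> (\<exists>\<kappa>. inner_calm_star_const \<Upsilon> a d \<kappa>)"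

text \<open>Only meaningful when \<open>inner_calm_star \<Upsilon> a d\<close> holds; otherwise the infimum is over \<open>{}\<close>.\<close>

definition inner_calm_star_modulus ::
  "('a::euclidean_space \<Rightarrow> 'b::euclidean_space set) \<Rightarrow> 'a \<Rightarrow> 'a \<Rightarrow> real" where
  "inner_calm_star_modulus \<Upsilon> a d =
     (if d \<notin> tangent_cone (sv_dom \<Upsilon>) a then 0 else Inf {\<kappa>. inner_calm_star_const \<Upsilon> a d \<kappa>})"

definition locally_uniformly_inner_calm_star ::
  "('a::euclidean_space \<Rightarrow> 'b::euclidean_space set) \<Rightarrow> 'a \<Rightarrow> 'a \<Rightarrow> bool" where
  "locally_uniformly_inner_calm_star \<Upsilon> a d \<longleftrightarrow>
     (\<exists>U N \<kappa>. a \<in> interior U \<and> d \<in> interior N \<and> \<kappa> > 0 \<and>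
        (\<forall>a'\<in>U \<inter> sv_dom \<Upsilon>. \<forall>d'\<in>N.
           inner_calm_star \<Upsilon> a' d' \<and> inner_calm_star_modulus \<Upsilon> a' d' \<le> \<kappa>))"

section \<open>Properties (A)--(D)\<close>

definition prop_A :: "('a::euclidean_space \<times> 'b::euclidean_space \<Rightarrow> ereal) \<Rightarrow> bool" where
  "prop_A f \<longleftrightarrow>
     (\<forall>(v, u, x) \<in> sv_dom (map_Y f). v \<in> subdiff_x f x u \<and> convex (map_Y f (v, u, x)))"

definition prop_B :: "('a::euclidean_space \<times> 'b::euclidean_space \<Rightarrow> ereal) \<Rightarrow> bool" where
  "prop_B f \<longleftrightarrow> closed (sv_gph (map_Y f))"

definition prop_C ::
  "('a::euclidean_space \<times> 'b::euclidean_space \<Rightarrow> ereal) \<Rightarrow> 'a \<Rightarrow> ('a \<times> 'b \<times> 'a) set \<Rightarrow> bool" where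
  "prop_C f xb W \<longleftrightarrow>
     closed (W \<inter> sv_dom (map_Y f)) \<and>
     (\<forall>(v, u, x) \<in> W.
        (v \<in> subdiff_x f x u \<longleftrightarrow> (\<exists>y. (v, y) \<in> lim_subdiff f (x, u))) \<and>
        ((\<exists>y. (v, y) \<in> lim_subdiff f (x, u)) \<longleftrightarrow> (v, u, x) \<in> sv_dom (map_Y f))) \<and>
     (\<exists>Z. closed Z \<and> ((xb, 0), 0) \<in> interior Z \<and>
        closed (Z \<inter> sv_gph (\<lambda>(x, u). subdiff_x f x u)))"

definition prop_D ::
  "('a::euclidean_space \<times> 'b::euclidean_space \<Rightarrow> ereal) \<Rightarrow> ('a \<times> 'b \<times> 'a) set \<Rightarrow> bool" where
  "prop_D f W \<longleftrightarrow> bounded (\<Union>w\<in>W. map_Y f w)"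

definition prop_CD :: "('a::euclidean_space \<times> 'b::euclidean_space \<Rightarrow> ereal) \<Rightarrow> 'a \<Rightarrow> bool" where
  "prop_CD f xb \<longleftrightarrow>
     (\<exists>W. closed W \<and> (0, 0, xb) \<in> interior W \<and> prop_C f xb W \<and> prop_D f W)"

section \<open>Composite form\<close>

definition twice_cont_diff :: "('a::euclidean_space \<Rightarrow> 'b::euclidean_space) \<Rightarrow> bool" where
  "twice_cont_diff h \<longleftrightarrow>
     (\<exists>(h' :: 'a \<Rightarrow> 'a \<Rightarrow>\<^sub>L 'b) (h'' :: 'a \<Rightarrow> 'a \<Rightarrow>\<^sub>L ('a \<Rightarrow>\<^sub>L 'b)).
        (\<forall>x. (h has_derivative blinfun_apply (h' x)) (at x)) \<and>
        (\<forall>x. (h' has_derivative blinfun_apply (h'' x)) (at x)) \<and>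
        continuous_on UNIV h'')"

definition composite_form ::
  "('a::euclidean_space \<times> 'b::euclidean_space \<Rightarrow> ereal) \<Rightarrow> ('a \<Rightarrow> real) \<Rightarrow> ('a \<Rightarrow> 'b) \<Rightarrow>
   ('b \<Rightarrow> ereal) \<Rightarrow> bool" where
  "composite_form f f0 F g \<longleftrightarrow>
     twice_cont_diff f0 \<and> twice_cont_diff F \<and>
     proper_fun g \<and> lower_semicont g \<and> convex_fun g \<and>
     (\<forall>x u. f (x, u) = ereal (f0 x) + g (F x + u))"

definition BQ :: "(real^'n \<Rightarrow> real^'m) \<Rightarrow> (real^'m \<Rightarrow> ereal) \<Rightarrow> real^'n \<Rightarrow> bool" where
  "BQ F g xb \<longleftrightarrow>
     (\<forall>y. transpose (jacobian F (at xb)) *v y = 0 \<and> y \<in> sing_subdiff g (F xb) \<longrightarrow> y = 0)"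

end

(*
  Isolated calmness of M bounds the x-part of every tangent to dom Y (hence to gph M1) by its
  (v,u)-part. Conversely, if calmness fails, normalising a violating sequence produces a tangent
  (0,0,d) to dom Y with |d| = 1; inner calmness* lifts it to a tangent of gph M1, with (B) placing
  the base point in the graph, a contradiction. The statements around the point follow by doing this
  at nearby points with uniform constants and extracting limits, for which (D) gives compactness.

  In the composite case, epi f and epi f(.,u) are preimages of the convex set epi g under smooth
  maps, so everything reduces to the chain rule for limiting normals to the preimage of a closed
  convex set. Its hard inclusion comes from a quadratic penalty: minimisers of
  e|x - w| - <eta, x - w> + c|Phi(x) - q|^2 over q in D yield approximate multipliers, and the
  qualification condition makes them converge after normalisation.
*)

theory Submission
  imports Defs
begin

section \<open>Tangents to the graphs of the multiplier mappings\<close>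

text \<open>Where the properties enter: (A) puts dom Y inside the graph of M, so calmness of M
  controls tangents to dom Y; the reverse local inclusion in (C) lets a failure of calmness produce
  such tangents. On the calm side, inner calmness* always holds through its first alternative: a
  direction (0,0,dx) with dx \<noteq> 0 is not tangent to dom Y, so no sequence of multipliers is
  ever built. On the other side, failure for one constant \<kappa> bounds (dv,du) only by
  1/\<kappa>, so \<kappa> has to grow in a second limit, taken among tangents; the normalisation
  |dx| = 1 survives both limits. In the composite case the qualification for the joint function is
  automatic, because u shifts the argument of g in every direction; this yields (A) and (B) at every
  point. With u frozen it is a genuine restriction, and (BQ) states it at the reference point alone,
  while (C) needs it on a neighbourhood. It is propagated by a uniform bound on multipliers: a cone
  contained in a bounded set is trivial.\<close>

lemma tendsto_inverse_Suc:
  fixes X :: "nat \<Rightarrow> 'a::metric_space"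
  assumes "\<And>k. dist (X k) l < inverse (real (Suc k))"
  shows "X \<longlonglongrightarrow> l"
  by (rule iffD2[OF tendsto_dist_iff], rule real_tendsto_sandwich[OF _ _ tendsto_const LIMSEQ_inverse_real_of_nat])
    (use assms in \<open>auto simp: less_imp_le simp del: of_nat_Suc\<close>)

text \<open>With sequences traded for a single \<epsilon>, closedness of the tangent cone becomes a
  triangle inequality instead of a diagonal argument.\<close>

lemma tangent_cone_iff:
  fixes C :: "'a::euclidean_space set"
  shows "d \<in> tangent_cone C z \<longleftrightarrow>
    (\<forall>e>0. \<exists>t d'. 0 < t \<and> t < e \<and> dist d' d < e \<and> z + t *\<^sub>R d' \<in> C)" (is "_ \<longleftrightarrow> ?R")
proof
  assume "d \<in> tangent_cone C z"
  then obtain dk t where dk: "dk \<longlonglongrightarrow> d" and t: "t \<longlonglongrightarrow> (0::real)"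
    and C: "\<And>k::nat. 0 < t k \<and> z + t k *\<^sub>R dk k \<in> C"
    unfolding tangent_cone_def by blast
  show ?R
  proof (intro allI impI)
    fix e :: real assume "e > 0"
    have "\<forall>\<^sub>F k in sequentially. dist (dk k) d < e" "\<forall>\<^sub>F k in sequentially. t k < e"
      using dk t \<open>e > 0\<close> by (auto simp: tendstoD order_tendstoD)
    then have "\<forall>\<^sub>F k in sequentially. dist (dk k) d < e \<and> t k < e"
      by eventually_elim auto
    then obtain k where "dist (dk k) d < e" "t k < e"
      using eventually_happens by fastforce
    then show "\<exists>t d'. 0 < t \<and> t < e \<and> dist d' d < e \<and> z + t *\<^sub>R d' \<in> C"
      using C by blast
  qed
next
  assume R: ?R
  have "\<forall>k::nat. \<exists>t d'. 0 < t \<and> t < inverse (real (Suc k)) \<and> dist d' d < inverse (real (Suc k))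
      \<and> z + t *\<^sub>R d' \<in> C"
    using R by simp
  then obtain t dk where *: "\<And>k::nat. 0 < t k \<and> t k < inverse (real (Suc k)) \<and>
      dist (dk k) d < inverse (real (Suc k)) \<and> z + t k *\<^sub>R dk k \<in> C"
    by metis
  have "dist (t k) 0 < inverse (real (Suc k))" for k
    using *[of k] by (simp add: dist_norm del: of_nat_Suc)
  then have "t \<longlonglongrightarrow> 0"
    by (rule tendsto_inverse_Suc)
  moreover have "dk \<longlonglongrightarrow> d"
    using * by (intro tendsto_inverse_Suc) blast
  ultimately show "d \<in> tangent_cone C z"
    using * unfolding tangent_cone_def by blast
qed

text \<open>Needed to pass from tangents with small (dv,du) at a fixed base point to a tangent of
  the form (0,0,l).\<close>

lemma closed_tangent_cone: "closed (tangent_cone C z)"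
proof -
  have "d \<in> tangent_cone C z" if *: "\<forall>e>0. \<exists>y\<in>tangent_cone C z. dist y d < e" for d
    unfolding tangent_cone_iff
  proof (intro allI impI)
    fix e :: real assume e: "e > 0"
    then obtain y where "y \<in> tangent_cone C z" and y: "dist y d < e / 2"
      using * half_gt_zero by blast
    then obtain t d' where t: "0 < t" "t < e / 2" "dist d' y < e / 2" "z + t *\<^sub>R d' \<in> C"
      using e unfolding tangent_cone_iff by (meson half_gt_zero)
    then have "dist d' d < e"
      using y dist_triangle_half_r[of y d' e d] by (simp add: dist_commute)
    then show "\<exists>t d'. 0 < t \<and> t < e \<and> dist d' d < e \<and> z + t *\<^sub>R d' \<in> C"
      using t e by (intro exI[of _ t] exI[of _ d']) auto
  qed
  then show ?thesis
    unfolding closure_subset_eq[symmetric] closure_approachable[symmetric] by blast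
qed

text \<open>Forgetting the multiplier is a linear map that sends gph M1 into dom Y, so it maps
  tangents to tangents.\<close>

lemma tangent_cone_M1_imp_dom_Y:
  assumes "((dv, du), (dx, dy)) \<in> tangent_cone (sv_gph (map_M1 f)) ((v, u), (x, y))"
  shows "(dv, du, dx) \<in> tangent_cone (sv_dom (map_Y f)) (v, u, x)"
proof -
  obtain dk t where dk: "dk \<longlonglongrightarrow> ((dv, du), (dx, dy))" and t: "t \<longlonglongrightarrow> (0::real)"
    and C: "\<And>k::nat. 0 < t k \<and> ((v, u), (x, y)) + t k *\<^sub>R dk k \<in> sv_gph (map_M1 f)"
    using assms unfolding tangent_cone_def by blast
  let ?p = "\<lambda>q. (fst (fst q), snd (fst q), fst (snd q))"
  have "(\<lambda>k. ?p (dk k)) \<longlonglongrightarrow> ?p ((dv, du), (dx, dy))"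
    by (intro tendsto_intros dk)
  moreover have "(v, u, x) + t k *\<^sub>R ?p (dk k) \<in> sv_dom (map_Y f)" for k
    using C[of k]
    by (cases "dk k") (auto simp: sv_gph_def map_M1_def sv_dom_def map_Y_def)
  moreover have "?p ((dv, du), (dx, dy)) = (dv, du, dx)"
    by simp
  ultimately show ?thesis
    unfolding tangent_cone_def using t C by (intro CollectI exI[of _ "\<lambda>k. ?p (dk k)"] exI[of _ t]) simp
qed

text \<open>The calmness inequality is positively homogeneous in the displacement, so the step
  length cancels. The tangent bound inherits exactly the constant \<kappa>, which keeps it uniform
  when calmness holds around the point.\<close>

lemma isolatedly_calm_tangent_bound:
  fixes f :: "'a::euclidean_space \<times> 'b::euclidean_space \<Rightarrow> ereal"
  assumes A: "prop_A f" and calm: "isolatedly_calm_const (map_M f) (v, u) x \<kappa>"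
    and tan: "(dv, du, dx) \<in> tangent_cone (sv_dom (map_Y f)) (v, u, x)"
  shows "norm dx \<le> \<kappa> * norm (dv, du)"
proof -
  obtain V where V: "x \<in> interior V"
    and cV: "\<And>a' b'. b' \<in> map_M f a' \<inter> V \<Longrightarrow> norm (b' - x) \<le> \<kappa> * norm (a' - (v, u))"
    using calm unfolding isolatedly_calm_const_def by blast
  obtain dk t where dk: "dk \<longlonglongrightarrow> (dv, du, dx)" and t: "t \<longlonglongrightarrow> (0::real)"
    and C: "\<And>k::nat. 0 < t k \<and> (v, u, x) + t k *\<^sub>R dk k \<in> sv_dom (map_Y f)"
    using tan unfolding tangent_cone_def by blast
  define dvk duk dxk where "dvk k = fst (dk k)" and "duk k = fst (snd (dk k))"
    and "dxk k = snd (snd (dk k))" for k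
  have dk_eq: "dk k = (dvk k, duk k, dxk k)" for k
    by (simp add: dvk_def duk_def dxk_def)
  have lims: "dvk \<longlonglongrightarrow> dv" "duk \<longlonglongrightarrow> du" "dxk \<longlonglongrightarrow> dx"
    using tendsto_fst[OF dk] tendsto_fst[OF tendsto_snd[OF dk]] tendsto_snd[OF tendsto_snd[OF dk]]
    by (simp_all add: dvk_def[abs_def] duk_def[abs_def] dxk_def[abs_def])
  have "(\<lambda>k. x + t k *\<^sub>R dxk k) \<longlonglongrightarrow> x + 0 *\<^sub>R dx"
    by (intro tendsto_intros t lims)
  then have "\<forall>\<^sub>F k in sequentially. x + t k *\<^sub>R dxk k \<in> interior V"
    using V by (intro topological_tendstoD) auto
  then have "\<forall>\<^sub>F k in sequentially. norm (dxk k) \<le> \<kappa> * norm (dvk k, duk k)"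
  proof eventually_elim
    case (elim k)
    \<comment> \<open>This is the use of (A): a point of dom Y satisfies v \<in> \<partial>_x
      f(x,u), hence it lies in the graph of M.\<close>
    have "x + t k *\<^sub>R dxk k \<in> map_M f (v + t k *\<^sub>R dvk k, u + t k *\<^sub>R duk k)"
      using C[of k] A unfolding prop_A_def map_M_def dk_eq by auto
    then have "norm (t k *\<^sub>R dxk k) \<le> \<kappa> * norm (t k *\<^sub>R (dvk k, duk k))"
      using cV[of "x + t k *\<^sub>R dxk k" "(v + t k *\<^sub>R dvk k, u + t k *\<^sub>R duk k)"] elim interior_subset
      by auto
    then have "t k * norm (dxk k) \<le> t k * (\<kappa> * norm (dvk k, duk k))"
      using C[of k] by (simp add: norm_scaleR mult_ac del: scaleR_Pair)
    then show ?case
      using C[of k] by simp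
  qed
  then show ?thesis
    by (rule tendsto_le[OF sequentially_bot tendsto_mult_left[OF tendsto_norm[OF tendsto_Pair]]
        tendsto_norm, OF lims])
qed

text \<open>The constant stays fixed here, so that the callers can let it grow; the base point is
  arbitrary, so that the same lemma serves failure at the reference point and at nearby
  points.\<close>

lemma not_isolatedly_calm_tangent:
  fixes f :: "'a::euclidean_space \<times> 'b::euclidean_space \<Rightarrow> ereal"
  assumes W: "(v, u, x) \<in> interior W"
    and dom: "\<And>v u x. (v, u, x) \<in> W \<Longrightarrow> v \<in> subdiff_x f x u \<Longrightarrow> (v, u, x) \<in> sv_dom (map_Y f)"
    and gph: "v \<in> subdiff_x f x u" and "\<kappa> > 0"
    and ncalm: "\<not> isolatedly_calm_const (map_M f) (v, u) x \<kappa>"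
  obtains dv du dx where "(dv, du, dx) \<in> tangent_cone (sv_dom (map_Y f)) (v, u, x)"
    and "norm dx = 1" and "norm (dv, du) \<le> 1 / \<kappa>"
proof -
  \<comment> \<open>Calmness with constant \<kappa> fails on every neighbourhood, in particular on
    the balls of radius 1/(k+1).\<close>
  have "\<exists>a' b'. b' \<in> map_M f a' \<inter> ball x (inverse (real (Suc k))) \<and> norm (b' - x) > \<kappa> * norm (a' - (v, u))" for k :: nat
  proof (rule ccontr)
    assume "\<not> ?thesis"
    then have "\<forall>a'. \<forall>b'\<in>map_M f a' \<inter> ball x (inverse (real (Suc k))).
        norm (b' - x) \<le> \<kappa> * norm (a' - (v, u))"
      by (meson linorder_not_less)
    moreover have "x \<in> interior (ball x (inverse (real (Suc k))))"
      by simp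
    ultimately show False
      using ncalm gph \<open>\<kappa> > 0\<close>
      unfolding isolatedly_calm_const_def sv_gph_def map_M_def by blast
  qed
  then obtain a b where ab: "\<And>k::nat. b k \<in> map_M f (a k)"
    and bx: "\<And>k. dist x (b k) < inverse (real (Suc k))"
    and less: "\<And>k. norm (b k - x) > \<kappa> * norm (a k - (v, u))"
    unfolding Int_iff mem_ball by metis
  \<comment> \<open>Dividing by the x-displacement alone makes the x-part a unit vector, while the
    violated inequality bounds the (v,u)-part by 1/\<kappa>. The displacement is nonzero because the
    violation is strict.\<close>
  define t where "t k = norm (b k - x)" for k
  have tpos: "t k > 0" for k
    using less[of k] \<open>\<kappa> > 0\<close> unfolding t_def
    by (meson le_less_trans less_imp_le mult_nonneg_nonneg norm_ge_zero)
  have t0: "t \<longlonglongrightarrow> 0"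
    by (rule tendsto_inverse_Suc)
      (use bx in \<open>simp add: t_def dist_norm norm_minus_commute del: of_nat_Suc\<close>)
  define d where "d k = (fst ((a k - (v, u)) /\<^sub>R t k), snd ((a k - (v, u)) /\<^sub>R t k), (b k - x) /\<^sub>R t k)" for k
  have n1: "norm (snd (snd (d k))) = 1" for k
    using tpos[of k] by (simp add: d_def t_def)
  have n2: "norm (fst (d k), fst (snd (d k))) \<le> 1 / \<kappa>" for k
  proof -
    have "norm (fst (d k), fst (snd (d k))) = norm (a k - (v, u)) / t k"
      using tpos[of k] by (simp only: d_def fst_conv snd_conv prod.collapse norm_scaleR)
        (simp add: divide_inverse_commute)
    also have "\<dots> \<le> 1 / \<kappa>"
      using less[of k] tpos[of k] \<open>\<kappa> > 0\<close> by (simp add: t_def field_simps)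
    finally show ?thesis .
  qed
  have "bounded (range d)"
  proof (rule boundedI)
    fix z assume "z \<in> range d"
    then obtain k where z: "z = d k" by blast
    have "norm z \<le> norm (fst (d k)) + (norm (fst (snd (d k))) + norm (snd (snd (d k))))"
      unfolding z using norm_Pair_le[of "fst (d k)" "snd (d k)"]
        norm_Pair_le[of "fst (snd (d k))" "snd (snd (d k))"] by simp
    also have "\<dots> \<le> 1 / \<kappa> + (1 / \<kappa> + 1)"
      using n1[of k] n2[of k] norm_fst_le[of "fst (d k)" "fst (snd (d k))"]
        norm_snd_le[of "fst (snd (d k))" "fst (d k)"] by linarith
    finally show "norm z \<le> 1 / \<kappa> + (1 / \<kappa> + 1)" .
  qed
  then obtain r l where r: "strict_mono (r :: nat \<Rightarrow> nat)" and l: "(d \<circ> r) \<longlonglongrightarrow> l"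
    using bounded_imp_convergent_subsequence by blast
  obtain dv du dx where leq: "l = (dv, du, dx)"
    by (metis prod.collapse)
  have eq: "(v, u, x) + t k *\<^sub>R d k = (fst (a k), snd (a k), b k)" for k
    using tpos[of k] by (simp add: d_def)
  have "(\<lambda>k. (v, u, x) + (t \<circ> r) k *\<^sub>R (d \<circ> r) k) \<longlonglongrightarrow> (v, u, x) + 0 *\<^sub>R l"
    by (intro tendsto_intros l LIMSEQ_subseq_LIMSEQ[OF t0 r])
  then have "\<forall>\<^sub>F k in sequentially. (v, u, x) + (t \<circ> r) k *\<^sub>R (d \<circ> r) k \<in> interior W"
    using W by (intro topological_tendstoD) auto
  then have ev: "\<forall>\<^sub>F k in sequentially. (v, u, x) + (t \<circ> r) k *\<^sub>R (d \<circ> r) k \<in> sv_dom (map_Y f)"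
  proof eventually_elim
    case (elim k)
    have "(fst (a (r k)), snd (a (r k)), b (r k)) \<in> W"
      using elim interior_subset unfolding o_def eq by blast
    moreover have "fst (a (r k)) \<in> subdiff_x f (b (r k)) (snd (a (r k)))"
      using ab[of "r k"] by (simp add: map_M_def case_prod_beta)
    ultimately show ?case
      unfolding o_def eq by (rule dom)
  qed
  \<comment> \<open>\<open>dom\<close> applies only once the points have entered W, whereas the
    tangent cone asks for membership at every index; hence the shift by K.\<close>
  then obtain K where K: "\<And>k. k \<ge> K \<Longrightarrow> (v, u, x) + (t \<circ> r) k *\<^sub>R (d \<circ> r) k \<in> sv_dom (map_Y f)"
    unfolding eventually_sequentially by blast
  have "(dv, du, dx) \<in> tangent_cone (sv_dom (map_Y f)) (v, u, x)"
    unfolding tangent_cone_def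
  proof (safe intro!: exI)
    show "(\<lambda>k. (d \<circ> r) (k + K)) \<longlonglongrightarrow> (dv, du, dx)"
      using l unfolding leq by (rule LIMSEQ_ignore_initial_segment)
    show "(\<lambda>k. (t \<circ> r) (k + K)) \<longlonglongrightarrow> 0"
      using LIMSEQ_subseq_LIMSEQ[OF t0 r] by (rule LIMSEQ_ignore_initial_segment)
  qed (use K tpos in auto)
  moreover have "(\<lambda>k. norm (snd (snd ((d \<circ> r) k)))) \<longlonglongrightarrow> norm (snd (snd l))"
    by (intro tendsto_intros l)
  then have "norm dx = 1"
    by (simp add: n1 leq LIMSEQ_const_iff)
  moreover have "(\<lambda>k. norm (fst ((d \<circ> r) k), fst (snd ((d \<circ> r) k)))) \<longlonglongrightarrow> norm (fst l, fst (snd l))"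
    by (intro tendsto_intros l)
  then have "norm (fst l, fst (snd l)) \<le> 1 / \<kappa>"
    by (rule LIMSEQ_le_const2) (use n2 in auto)
  then have "norm (dv, du) \<le> 1 / \<kappa>"
    by (simp add: leq)
  ultimately show thesis
    by (rule that)
qed

text \<open>The fuzzy notion does not say that the limit multiplier belongs to Y(v,u,x); closedness
  of gph Y supplies this. The calmness estimate bounds the difference quotients of the multipliers,
  and a cluster point of them is dy. The norm bound on dy is kept for the compactness argument over
  varying base points.\<close>

lemma inner_calm_star_tangent_M1:
  fixes f :: "'a::euclidean_space \<times> 'b::euclidean_space \<Rightarrow> ereal"
  assumes B: "prop_B f"
    and calm: "inner_calm_star_const (map_Y f) (v, u, x) (dv, du, dx) \<kappa>"
  obtains y dy where "y \<in> map_Y f (v, u, x)" and "norm dy \<le> \<kappa> * norm (dv, du, dx)"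
    and "((dv, du), (dx, dy)) \<in> tangent_cone (sv_gph (map_M1 f)) ((v, u), (x, y))"
proof -
  obtain y dk t yk where dk: "dk \<longlonglongrightarrow> (dv, du, dx)" and t: "t \<longlonglongrightarrow> 0"
    and yk: "yk \<longlonglongrightarrow> y" and tpos: "\<And>k::nat. 0 < t k"
    and mem: "\<And>k. yk k \<in> map_Y f ((v, u, x) + t k *\<^sub>R dk k)"
    and le: "\<And>k. norm (yk k - y) \<le> \<kappa> * t k * norm (dk k)"
    using calm unfolding inner_calm_star_const_def by blast
  have "(\<lambda>k. ((v, u, x) + t k *\<^sub>R dk k, yk k)) \<longlonglongrightarrow> ((v, u, x) + 0 *\<^sub>R (dv, du, dx), y)"
    by (intro tendsto_intros dk t yk)
  then have "((v, u, x) + 0 *\<^sub>R (dv, du, dx), y) \<in> sv_gph (map_Y f)"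
    by (rule closed_sequentially[OF B[unfolded prop_B_def], rotated]) (simp add: sv_gph_def mem)
  then have y: "y \<in> map_Y f (v, u, x)"
    by (simp add: sv_gph_def)
  define dyk where "dyk k = (yk k - y) /\<^sub>R t k" for k
  have dyle: "norm (dyk k) \<le> \<kappa> * norm (dk k)" for k
  proof -
    have "norm (dyk k) = norm (yk k - y) / t k"
      using tpos[of k] by (simp add: dyk_def divide_inverse_commute)
    also have "\<dots> \<le> \<kappa> * norm (dk k)"
      using le[of k] tpos[of k] by (simp add: divide_le_eq mult_ac)
    finally show ?thesis .
  qed
  obtain B where B: "\<And>k. norm (dk k) \<le> B"
    using convergent_imp_Bseq[OF convergentI[OF dk]] unfolding Bseq_def by blast
  have "\<kappa> > 0"
    using calm unfolding inner_calm_star_const_def by blast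
  then have "norm (dyk k) \<le> \<kappa> * B" for k
    using dyle[of k] B[of k] by (meson mult_left_mono less_imp_le order_trans)
  then have "bounded (range dyk)"
    by (auto intro!: boundedI)
  then obtain r dy where r: "strict_mono (r :: nat \<Rightarrow> nat)" and dy: "(dyk \<circ> r) \<longlonglongrightarrow> dy"
    using bounded_imp_convergent_subsequence by blast
  have dkr: "(dk \<circ> r) \<longlonglongrightarrow> (dv, du, dx)" and tr: "(t \<circ> r) \<longlonglongrightarrow> 0"
    using LIMSEQ_subseq_LIMSEQ[OF dk r] LIMSEQ_subseq_LIMSEQ[OF t r] .
  let ?p = "\<lambda>d. \<lambda>e. ((fst d, fst (snd d)), (snd (snd d), e))"
  have "(\<lambda>k. ?p ((dk \<circ> r) k) ((dyk \<circ> r) k)) \<longlonglongrightarrow> ?p (dv, du, dx) dy"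
    by (intro tendsto_intros dkr dy)
  moreover have "((v, u), (x, y)) + (t \<circ> r) k *\<^sub>R ?p ((dk \<circ> r) k) ((dyk \<circ> r) k) \<in> sv_gph (map_M1 f)" for k
    using mem[of "r k"] tpos[of "r k"]
    by (cases "dk (r k)") (auto simp: sv_gph_def map_M1_def map_Y_def dyk_def)
  ultimately have "?p (dv, du, dx) dy \<in> tangent_cone (sv_gph (map_M1 f)) ((v, u), (x, y))"
    unfolding tangent_cone_def using tr tpos
    by (intro CollectI exI[of _ "\<lambda>k. ?p ((dk \<circ> r) k) ((dyk \<circ> r) k)"] exI[of _ "t \<circ> r"]) simp
  moreover have "norm dy \<le> \<kappa> * norm (dv, du, dx)"
    by (rule tendsto_le[OF sequentially_bot tendsto_mult_left[OF tendsto_norm[OF dkr]]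
        tendsto_norm[OF dy]]) (simp add: dyle)
  ultimately show thesis
    by (intro that[OF y]) (simp_all only: fst_conv snd_conv)
qed

section \<open>Limiting normals to preimages of convex sets\<close>

text \<open>The normal cone of convex analysis. Membership of q in D is left out, so a limit of
  normals at moving points is obtained from the inequalities alone.\<close>

definition conv_normal :: "'a::real_inner set \<Rightarrow> 'a \<Rightarrow> 'a set" where
  "conv_normal D q = {\<nu>. \<forall>q'\<in>D. \<nu> \<bullet> (q' - q) \<le> 0}"

lemma conv_normal_scaleR: "\<nu> \<in> conv_normal D q \<Longrightarrow> 0 \<le> c \<Longrightarrow> c *\<^sub>R \<nu> \<in> conv_normal D q"
  by (simp add: conv_normal_def mult_nonneg_nonpos)

lemma conv_normal_limit:
  assumes "\<And>k. \<nu> k \<in> conv_normal D (q k)" and "\<nu> \<longlonglongrightarrow> l" and "q \<longlonglongrightarrow> p"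
  shows "l \<in> conv_normal D p"
  unfolding conv_normal_def
proof (intro CollectI ballI)
  fix q' assume q': "q' \<in> D"
  have "(\<lambda>k. \<nu> k \<bullet> (q' - q k)) \<longlonglongrightarrow> l \<bullet> (q' - p)"
    by (intro tendsto_intros assms)
  then show "l \<bullet> (q' - p) \<le> 0"
    by (rule LIMSEQ_le_const2) (use assms(1) q' in \<open>auto simp: conv_normal_def\<close>)
qed

text \<open>As the penalty weight grows, cluster points of minimisers satisfy \<Phi> x = q \<in> D,
  so they are feasible; the regular normal inequality then leaves only x = w. Hence for a large
  weight the minimiser is strictly inside both balls, and the localisation does not affect
  first-order conditions.\<close>

lemma penalized_minimizer:
  fixes \<Phi> :: "'a::euclidean_space \<Rightarrow> 'b::euclidean_space"
  assumes D: "closed D" and cont: "continuous_on UNIV \<Phi>"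
    and \<eta>: "\<eta> \<in> regular_normal_cone (\<Phi> -` D) w" and e: "e > 0"
  obtains c x q r where "c > 0" "r > 0" "norm (x - w) < r" "norm (x - w) < e"
    "norm (q - \<Phi> w) < 1" "norm (q - \<Phi> w) < e" "q \<in> D"
    "\<And>x' q'. norm (x' - w) \<le> r \<Longrightarrow> q' \<in> D \<Longrightarrow> norm (q' - \<Phi> w) \<le> 1 \<Longrightarrow>
       e * norm (x - w) - \<eta> \<bullet> (x - w) + c * (norm (\<Phi> x - q))\<^sup>2
       \<le> e * norm (x' - w) - \<eta> \<bullet> (x' - w) + c * (norm (\<Phi> x' - q'))\<^sup>2"
proof -
  have wD: "\<Phi> w \<in> D"
    using \<eta> by (simp add: regular_normal_cone_def)
  \<comment> \<open>Asking for e/2 while the penalised objective carries e leaves the surplus e/2 *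
    |x - w| that later forces x = w.\<close>
  obtain \<delta> where "\<delta> > 0"
    and \<delta>: "\<And>z. \<Phi> z \<in> D \<Longrightarrow> norm (z - w) < \<delta> \<Longrightarrow> \<eta> \<bullet> (z - w) \<le> e / 2 * norm (z - w)"
    using \<eta> e half_gt_zero[OF e] unfolding regular_normal_cone_def by blast
  define r where "r = \<delta> / 2"
  have r: "r > 0" "r < \<delta>"
    using \<open>\<delta> > 0\<close> by (auto simp: r_def)
  \<comment> \<open>D may be unbounded; the unit ball around \<Phi> w makes the minimisation
    compact.\<close>
  define S where "S = cball w r \<times> (D \<inter> cball (\<Phi> w) 1)"
  have "compact S"
    unfolding S_def using D by (intro compact_Times compact_cball closed_Int_compact)
  have wS: "(w, \<Phi> w) \<in> S"
    using r wD by (simp add: S_def)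
  define \<theta> where "\<theta> k p = e * norm (fst p - w) - \<eta> \<bullet> (fst p - w)
      + real (Suc k) * (norm (\<Phi> (fst p) - snd p))\<^sup>2" for k :: nat and p
  have cfst: "continuous_on S (\<lambda>p. \<Phi> (fst p))" for S :: "('a \<times> 'b) set"
    by (rule continuous_on_compose2[OF cont continuous_on_fst]) (auto intro: continuous_on_id)
  have "\<exists>p\<in>S. \<forall>p'\<in>S. \<theta> k p \<le> \<theta> k p'" for k
    using wS \<open>compact S\<close> unfolding \<theta>_def
    by (intro continuous_attains_inf continuous_intros cfst) auto
  then obtain p where pS: "\<And>k. p k \<in> S" and pmin: "\<And>k p'. p' \<in> S \<Longrightarrow> \<theta> k (p k) \<le> \<theta> k p'"
    by metis
  \<comment> \<open>The feasible pair (w, \<Phi> w) has objective value 0; this comparison drives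
    both limits below.\<close>
  have p0: "\<theta> k (p k) \<le> 0" for k
    using pmin[OF wS, of k] by (simp add: \<theta>_def)
  obtain l s where lS: "l \<in> S" and s: "strict_mono (s :: nat \<Rightarrow> nat)" and l: "(p \<circ> s) \<longlonglongrightarrow> l"
    using \<open>compact S\<close> pS unfolding compact_def by blast
  have cs: "(\<lambda>k. \<Phi> (fst ((p \<circ> s) k))) \<longlonglongrightarrow> \<Phi> (fst l)"
    using cont by (intro isCont_tendsto_compose[OF _ tendsto_fst[OF l]])
      (simp add: continuous_on_eq_continuous_at)
  have lims: "(\<lambda>k. (norm (\<Phi> (fst ((p \<circ> s) k)) - snd ((p \<circ> s) k)))\<^sup>2)
      \<longlonglongrightarrow> (norm (\<Phi> (fst l) - snd l))\<^sup>2"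
    by (intro tendsto_intros l cs)
  have bound: "(norm (\<Phi> (fst (p k)) - snd (p k)))\<^sup>2 \<le> norm \<eta> * r * inverse (real (Suc k))" for k
  proof -
    have "\<eta> \<bullet> (fst (p k) - w) \<le> norm \<eta> * norm (fst (p k) - w)"
      by (rule norm_cauchy_schwarz)
    also have "\<dots> \<le> norm \<eta> * r"
      using pS[of k] by (intro mult_left_mono)
        (auto simp: S_def mem_Times_iff dist_norm norm_minus_commute)
    finally have "real (Suc k) * (norm (\<Phi> (fst (p k)) - snd (p k)))\<^sup>2 \<le> norm \<eta> * r"
      using p0[of k] mult_nonneg_nonneg[OF less_imp_le[OF e] norm_ge_zero[of "fst (p k) - w"]] unfolding \<theta>_def by linarith
    then show ?thesis
      by (simp add: field_simps del: of_nat_Suc)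
  qed
  have "(\<lambda>k. norm \<eta> * r * inverse (real (Suc k))) \<longlonglongrightarrow> norm \<eta> * r * 0"
    by (intro tendsto_mult_left LIMSEQ_inverse_real_of_nat)
  then have "(\<lambda>k. norm \<eta> * r * inverse (real (Suc (s k)))) \<longlonglongrightarrow> 0"
    using LIMSEQ_subseq_LIMSEQ[OF _ s] by (fastforce simp: o_def)
  then have "(norm (\<Phi> (fst l) - snd l))\<^sup>2 \<le> 0"
    by (rule LIMSEQ_le[OF lims]) (use bound in auto)
  then have l1: "\<Phi> (fst l) = snd l"
    by simp
  have "(\<lambda>k. e * norm (fst ((p \<circ> s) k) - w) - \<eta> \<bullet> (fst ((p \<circ> s) k) - w))
      \<longlonglongrightarrow> e * norm (fst l - w) - \<eta> \<bullet> (fst l - w)"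
    by (intro tendsto_intros l)
  moreover have "e * norm (fst (p k) - w) - \<eta> \<bullet> (fst (p k) - w) \<le> 0" for k
    using p0[of k] mult_nonneg_nonneg[OF of_nat_0_le_iff[of "Suc k"] zero_le_power2[of "norm (\<Phi> (fst (p k)) - snd (p k))"]]
    unfolding \<theta>_def by linarith
  \<comment> \<open>The limit is feasible by \<open>l1\<close>, so minimality in the limit can be
    played against the regular normal inequality.\<close>
  ultimately have "e * norm (fst l - w) - \<eta> \<bullet> (fst l - w) \<le> 0"
    by (intro LIMSEQ_le_const2) auto
  moreover have "\<eta> \<bullet> (fst l - w) \<le> e / 2 * norm (fst l - w)"
    using lS r by (intro \<delta>) (auto simp: l1 S_def mem_Times_iff dist_norm norm_minus_commute)
  ultimately have "e / 2 * norm (fst l - w) \<le> 0"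
    by argo
  then have l2: "fst l = w"
    using e by (simp add: mult_le_0_iff)
  have "\<forall>\<^sub>F k in sequentially. dist (fst ((p \<circ> s) k)) w < min r e"
    using tendsto_fst[OF l] r e unfolding l2 by (intro tendstoD) auto
  moreover have "\<forall>\<^sub>F k in sequentially. dist (snd ((p \<circ> s) k)) (\<Phi> w) < min 1 e"
    using tendsto_snd[OF l] e unfolding l1[symmetric] l2 by (intro tendstoD) auto
  ultimately have "\<forall>\<^sub>F k in sequentially. dist (fst ((p \<circ> s) k)) w < min r e \<and>
      dist (snd ((p \<circ> s) k)) (\<Phi> w) < min 1 e"
    by eventually_elim auto
  then obtain j where j: "dist (fst ((p \<circ> s) j)) w < min r e" "dist (snd ((p \<circ> s) j)) (\<Phi> w) < min 1 e"
    using eventually_happens by fastforce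
  show thesis
  proof (rule that[of "real (Suc (s j))" r "fst (p (s j))" "snd (p (s j))"])
    fix x' q' assume *: "norm (x' - w) \<le> r" "q' \<in> D" "norm (q' - \<Phi> w) \<le> 1"
    have "(x', q') \<in> S"
      using * by (simp add: S_def dist_norm norm_minus_commute)
    from pmin[OF this, of "s j"]
    show "e * norm (fst (p (s j)) - w) - \<eta> \<bullet> (fst (p (s j)) - w)
        + real (Suc (s j)) * (norm (\<Phi> (fst (p (s j))) - snd (p (s j))))\<^sup>2
       \<le> e * norm (x' - w) - \<eta> \<bullet> (x' - w) + real (Suc (s j)) * (norm (\<Phi> x' - q'))\<^sup>2"
      by (simp add: \<theta>_def)
  qed (use j r pS[of "s j"] in \<open>auto simp: dist_norm S_def mem_Times_iff\<close>)
qed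

text \<open>First-order conditions at the penalised minimiser: optimality in q makes q a projection
  of \<Phi> x onto D, and optimality in x balances \<eta> with the derivative of the penalty up to
  the slope e of the norm term.\<close>

lemma fuzzy_normal_preimage:
  fixes \<Phi> :: "'a::euclidean_space \<Rightarrow> 'b::euclidean_space"
  assumes D: "closed D" "convex D" and der: "\<And>x. (\<Phi> has_derivative \<Phi>' x) (at x)"
    and \<eta>: "\<eta> \<in> regular_normal_cone (\<Phi> -` D) w" and e: "e > 0"
  obtains x q \<nu> where "dist x w < e" "dist q (\<Phi> w) < e" "\<nu> \<in> conv_normal D q"
    "\<And>h. \<bar>\<eta> \<bullet> h - \<nu> \<bullet> \<Phi>' x h\<bar> \<le> e * norm h"
proof -
  have cont: "continuous_on UNIV \<Phi>"
    using der by (meson continuous_at_imp_continuous_on has_derivative_continuous)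
  obtain c x q r where "c > 0" "r > 0" and xr: "norm (x - w) < r" and xe: "norm (x - w) < e"
    and q1: "norm (q - \<Phi> w) < 1" and qe: "norm (q - \<Phi> w) < e" and qD: "q \<in> D"
    and min: "\<And>x' q'. norm (x' - w) \<le> r \<Longrightarrow> q' \<in> D \<Longrightarrow> norm (q' - \<Phi> w) \<le> 1 \<Longrightarrow>
       e * norm (x - w) - \<eta> \<bullet> (x - w) + c * (norm (\<Phi> x - q))\<^sup>2
       \<le> e * norm (x' - w) - \<eta> \<bullet> (x' - w) + c * (norm (\<Phi> x' - q'))\<^sup>2"
    by (rule penalized_minimizer[OF D(1) cont \<eta> e]) (rule that)
  \<comment> \<open>The gradient of the penalty c|z - q|^2 at z = \<Phi> x; the same vector is the
    multiplier in both optimality conditions.\<close>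
  define \<nu> where "\<nu> = (2 * c) *\<^sub>R (\<Phi> x - q)"
  have closest: "(\<Phi> x - q) \<bullet> (q' - q) \<le> 0" if "q' \<in> D" "norm (q' - \<Phi> w) \<le> 1" for q'
  proof (rule any_closest_point_dot[of "D \<inter> cball (\<Phi> w) 1"])
    show "\<forall>z\<in>D \<inter> cball (\<Phi> w) 1. dist (\<Phi> x) q \<le> dist (\<Phi> x) z"
    proof
      fix z assume "z \<in> D \<inter> cball (\<Phi> w) 1"
      then have "c * (norm (\<Phi> x - q))\<^sup>2 \<le> c * (norm (\<Phi> x - z))\<^sup>2"
        using min[of x z] xr by (simp add: dist_norm norm_minus_commute)
      then show "dist (\<Phi> x) q \<le> dist (\<Phi> x) z"
        using \<open>c > 0\<close> by (simp add: dist_norm)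
    qed
  qed (use D q1 qD that in \<open>auto simp: convex_Int closed_Int dist_norm norm_minus_commute\<close>)
  have "\<nu> \<in> conv_normal D q"
    unfolding conv_normal_def
  proof (intro CollectI ballI)
    fix q' assume q': "q' \<in> D"
    \<comment> \<open>The projection property holds only on D cut by the unit ball. Since q lies
      strictly inside that ball, a short initial piece of each segment from q into D stays in it,
      and the inequality scales to the whole segment.\<close>
    have "((\<lambda>t. norm (q + t *\<^sub>R (q' - q) - \<Phi> w)) \<longlongrightarrow> norm (q + 0 *\<^sub>R (q' - q) - \<Phi> w)) (at_right (0::real))"
      by (intro tendsto_intros)
    then have "\<forall>\<^sub>F t in at_right 0. norm (q + t *\<^sub>R (q' - q) - \<Phi> w) < 1"
      using q1 by (intro order_tendstoD(2)) auto
    moreover have "\<forall>\<^sub>F t in at_right (0::real). 0 < t \<and> t < 1"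
      by (auto simp: eventually_at_right_field intro!: exI[of _ 1])
    ultimately have "\<forall>\<^sub>F t in at_right 0. norm (q + t *\<^sub>R (q' - q) - \<Phi> w) < 1 \<and> 0 < t \<and> t < 1"
      by eventually_elim auto
    then obtain t :: real where t: "norm (q + t *\<^sub>R (q' - q) - \<Phi> w) < 1" "0 < t" "t < 1"
      using eventually_happens[of _ "at_right (0::real)"] trivial_limit_at_right_real by blast
    have "q + t *\<^sub>R (q' - q) = (1 - t) *\<^sub>R q + t *\<^sub>R q'"
      by (simp add: algebra_simps)
    then have "q + t *\<^sub>R (q' - q) \<in> D"
      using t D(2) qD q' by (simp add: convexD)
    then have "(\<Phi> x - q) \<bullet> (q + t *\<^sub>R (q' - q) - q) \<le> 0"
      using t by (intro closest) auto
    then have "t * ((\<Phi> x - q) \<bullet> (q' - q)) \<le> 0"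
      by simp
    then have "(\<Phi> x - q) \<bullet> (q' - q) \<le> 0"
      using t(2) by (simp add: mult_le_0_iff)
    then show "\<nu> \<bullet> (q' - q) \<le> 0"
      using \<open>c > 0\<close> by (simp add: \<nu>_def mult_le_0_iff)
  qed
  moreover have upper: "\<eta> \<bullet> h - \<nu> \<bullet> \<Phi>' x h \<le> e * norm h" for h
  proof (rule ccontr)
    assume "\<not> ?thesis"
    then have neg: "e * norm h - \<eta> \<bullet> h + \<nu> \<bullet> \<Phi>' x h < 0"
      by simp
    \<comment> \<open>The norm term may fail to be differentiable at x, so along the ray it is
      replaced by its triangle upper bound, without the constant e|x - w|. The bound is exact at t =
      0, so minimality still gives \<psi> 0 \<le> \<psi> t.\<close>
    define \<psi> where "\<psi> t = t * (e * norm h) - \<eta> \<bullet> (x + t *\<^sub>R h - w) + c * (norm (\<Phi> (x + t *\<^sub>R h) - q))\<^sup>2"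
      for t :: real
    have lin: "linear (\<Phi>' x)"
      using der has_derivative_linear by blast
    have "((\<lambda>t. x + t *\<^sub>R h) has_derivative (\<lambda>t. t *\<^sub>R h)) (at (0::real))"
      by (auto intro!: derivative_eq_intros)
    then have "((\<lambda>t. \<Phi> (x + t *\<^sub>R h)) has_derivative (\<lambda>t. \<Phi>' x (t *\<^sub>R h))) (at (0::real))"
      using has_derivative_compose[of "\<lambda>t. x + t *\<^sub>R h" "\<lambda>t. t *\<^sub>R h" "0::real" UNIV \<Phi> "\<Phi>' x"] der[of x]
      by simp
    then have d: "((\<lambda>t. \<Phi> (x + t *\<^sub>R h)) has_derivative (\<lambda>t. t *\<^sub>R \<Phi>' x h)) (at (0::real))"
      by (simp add: linear_cmul[OF lin])
    have "(\<psi> has_derivative (\<lambda>t. (e * norm h - \<eta> \<bullet> h + \<nu> \<bullet> \<Phi>' x h) * t)) (at 0)"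
      unfolding \<psi>_def[abs_def] dot_square_norm[symmetric]
      by (rule derivative_eq_intros d refl | simp)+
        (simp add: \<nu>_def fun_eq_iff algebra_simps inner_commute)
    then have "DERIV \<psi> 0 :> e * norm h - \<eta> \<bullet> h + \<nu> \<bullet> \<Phi>' x h"
      by (simp add: has_field_derivative_def mult_commute_abs)
    from DERIV_neg_dec_right[OF this neg]
    obtain \<delta> where "\<delta> > 0" and \<delta>: "\<And>t. 0 < t \<Longrightarrow> t < \<delta> \<Longrightarrow> \<psi> t < \<psi> 0"
      by auto
    have "((\<lambda>t. norm (x + t *\<^sub>R h - w)) \<longlongrightarrow> norm (x + 0 *\<^sub>R h - w)) (at_right (0::real))"
      by (intro tendsto_intros)
    then have "\<forall>\<^sub>F t in at_right 0. norm (x + t *\<^sub>R h - w) < r"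
      using xr by (intro order_tendstoD(2)) auto
    moreover have "\<forall>\<^sub>F t in at_right (0::real). 0 < t \<and> t < \<delta>"
      using \<open>\<delta> > 0\<close> by (auto simp: eventually_at_right_field intro!: exI[of _ \<delta>])
    ultimately have "\<forall>\<^sub>F t in at_right 0. norm (x + t *\<^sub>R h - w) < r \<and> 0 < t \<and> t < \<delta>"
      by eventually_elim auto
    then obtain t :: real where t: "norm (x + t *\<^sub>R h - w) < r" "0 < t" "t < \<delta>"
      using eventually_happens[of _ "at_right (0::real)"] trivial_limit_at_right_real by blast
    have "norm (x + t *\<^sub>R h - w) \<le> norm (x - w) + t * norm h"
      using norm_triangle_ineq[of "x - w" "t *\<^sub>R h"] t by (simp add: algebra_simps)
    then have "e * norm (x + t *\<^sub>R h - w) \<le> e * norm (x - w) + t * (e * norm h)"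
      using mult_left_mono[of _ _ e] e by (fastforce simp: algebra_simps)
    moreover have "e * norm (x - w) - \<eta> \<bullet> (x - w) + c * (norm (\<Phi> x - q))\<^sup>2
       \<le> e * norm (x + t *\<^sub>R h - w) - \<eta> \<bullet> (x + t *\<^sub>R h - w) + c * (norm (\<Phi> (x + t *\<^sub>R h) - q))\<^sup>2"
      using t q1 qD by (intro min) auto
    ultimately have "\<psi> 0 \<le> \<psi> t"
      by (simp add: \<psi>_def)
    then show False
      using \<delta>[OF t(2,3)] by simp
  qed
  moreover have "\<bar>\<eta> \<bullet> h - \<nu> \<bullet> \<Phi>' x h\<bar> \<le> e * norm h" for h
    using upper[of h] upper[of "- h"] linear_neg[OF has_derivative_linear[OF der], of x h] by simp
  ultimately show thesis
    using xe qe by (intro that[of x q \<nu>]) (auto simp: dist_norm)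
qed

text \<open>The approximate multipliers may be unbounded, so the identity is passed to the limit in
  homogeneous form, with a coefficient \<sigma> in front of \<eta>; the qualification condition is
  exactly what excludes \<sigma> = 0.\<close>

lemma limiting_normal_preimage_multiplier:
  fixes \<Phi> :: "'a::euclidean_space \<Rightarrow> 'b::euclidean_space"
  assumes D: "closed D" "convex D" and der: "\<And>x. (\<Phi> has_derivative \<Phi>' x) (at x)"
    and cont: "\<And>h. isCont (\<lambda>x. \<Phi>' x h) w"
    and CQ: "\<And>\<nu>. \<nu> \<in> conv_normal D (\<Phi> w) \<Longrightarrow> (\<And>h. \<nu> \<bullet> \<Phi>' w h = 0) \<Longrightarrow> \<nu> = 0"
    and \<eta>: "\<eta> \<in> limiting_normal_cone (\<Phi> -` D) w"
  obtains \<nu> where "\<nu> \<in> conv_normal D (\<Phi> w)" and "\<And>h. \<eta> \<bullet> h = \<nu> \<bullet> \<Phi>' w h"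
proof -
  obtain z \<zeta> where z: "z \<longlonglongrightarrow> w" and \<zeta>: "\<zeta> \<longlonglongrightarrow> \<eta>"
    and reg: "\<And>k::nat. \<zeta> k \<in> regular_normal_cone (\<Phi> -` D) (z k)"
    using \<eta> unfolding limiting_normal_cone_def by blast
  have "\<exists>x q \<nu>. dist x (z k) < inverse (real (Suc k)) \<and> dist q (\<Phi> (z k)) < inverse (real (Suc k)) \<and>
      \<nu> \<in> conv_normal D q \<and> (\<forall>h. \<bar>\<zeta> k \<bullet> h - \<nu> \<bullet> \<Phi>' x h\<bar> \<le> inverse (real (Suc k)) * norm h)" for k
    by (rule fuzzy_normal_preimage[OF D der reg[of k], of "inverse (real (Suc k))"]) (simp, blast)
  then obtain x q \<nu> where x: "\<And>k. dist (x k) (z k) < inverse (real (Suc k))"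
    and q: "\<And>k. dist (q k) (\<Phi> (z k)) < inverse (real (Suc k))"
    and \<nu>: "\<And>k. \<nu> k \<in> conv_normal D (q k)"
    and err: "\<And>k h. \<bar>\<zeta> k \<bullet> h - \<nu> k \<bullet> \<Phi>' (x k) h\<bar> \<le> inverse (real (Suc k)) * norm h"
    by metis
  have isC: "isCont \<Phi> w"
    using der has_derivative_continuous by blast
  have near: "X \<longlonglongrightarrow> l" if "\<And>k. dist (X k) (Y k) < inverse (real (Suc k))" "Y \<longlonglongrightarrow> l"
    for X Y :: "nat \<Rightarrow> 'c::real_normed_vector" and l
  proof -
    have "(\<lambda>k. X k - Y k) \<longlonglongrightarrow> 0"
      using that(1) by (intro tendsto_inverse_Suc) (simp add: dist_norm del: of_nat_Suc)
    from tendsto_add[OF this that(2)] show ?thesis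
      by simp
  qed
  have xw: "x \<longlonglongrightarrow> w"
    using x z by (rule near)
  have qw: "q \<longlonglongrightarrow> \<Phi> w"
    using q isCont_tendsto_compose[OF isC z] by (rule near)
  \<comment> \<open>This scaling gives s + |s \<nu>| = 1, so bounded and unbounded multipliers are
    treated alike and the limit pair (\<sigma>, \<mu>) cannot vanish.\<close>
  define s where "s k = inverse (1 + norm (\<nu> k))" for k
  have spos: "s k > 0" for k
    unfolding s_def by (simp add: add_pos_nonneg)
  have s1: "s k + norm (s k *\<^sub>R \<nu> k) = 1" for k
  proof -
    have "s k + norm (s k *\<^sub>R \<nu> k) = s k * (1 + norm (\<nu> k))"
      using spos[of k] by (simp add: algebra_simps)
    also have "\<dots> = 1"
      unfolding s_def using norm_ge_zero[of "\<nu> k"] by (intro left_inverse) linarith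
    finally show ?thesis .
  qed
  have "bounded (range (\<lambda>k. (s k, s k *\<^sub>R \<nu> k)))"
  proof (rule boundedI)
    fix p assume "p \<in> range (\<lambda>k. (s k, s k *\<^sub>R \<nu> k))"
    then obtain k where "p = (s k, s k *\<^sub>R \<nu> k)" by blast
    then show "norm p \<le> 1"
      using norm_Pair_le[of "s k" "s k *\<^sub>R \<nu> k"] s1[of k] spos[of k] by simp
  qed
  then obtain r p where r: "strict_mono (r :: nat \<Rightarrow> nat)" and p: "((\<lambda>k. (s k, s k *\<^sub>R \<nu> k)) \<circ> r) \<longlonglongrightarrow> p"
    using bounded_imp_convergent_subsequence by blast
  define \<sigma> \<mu> where "\<sigma> = fst p" and "\<mu> = snd p"
  have \<sigma>: "(\<lambda>k. s (r k)) \<longlonglongrightarrow> \<sigma>" and \<mu>: "(\<lambda>k. s (r k) *\<^sub>R \<nu> (r k)) \<longlonglongrightarrow> \<mu>"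
    using tendsto_fst[OF p] tendsto_snd[OF p] by (simp_all add: o_def \<sigma>_def \<mu>_def)
  have "(\<lambda>k. s (r k) + norm (s (r k) *\<^sub>R \<nu> (r k))) \<longlonglongrightarrow> \<sigma> + norm \<mu>"
    by (intro tendsto_intros \<sigma> \<mu>)
  then have sum1: "\<sigma> + norm \<mu> = 1"
    by (simp only: s1 LIMSEQ_const_iff)
  have \<sigma>0: "\<sigma> \<ge> 0"
    using \<sigma> by (rule LIMSEQ_le_const) (use spos less_imp_le in blast)
  have qr: "(\<lambda>k. q (r k)) \<longlonglongrightarrow> \<Phi> w" and xr: "(\<lambda>k. x (r k)) \<longlonglongrightarrow> w" and \<zeta>r: "(\<lambda>k. \<zeta> (r k)) \<longlonglongrightarrow> \<eta>"
    using LIMSEQ_subseq_LIMSEQ[OF qw r] LIMSEQ_subseq_LIMSEQ[OF xw r] LIMSEQ_subseq_LIMSEQ[OF \<zeta> r]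
    by (simp_all add: o_def)
  have \<mu>N: "\<mu> \<in> conv_normal D (\<Phi> w)"
    by (rule conv_normal_limit[OF _ \<mu> qr]) (use \<nu> spos in \<open>auto intro: conv_normal_scaleR less_imp_le\<close>)
  have eq: "\<sigma> * (\<eta> \<bullet> h) = \<mu> \<bullet> \<Phi>' w h" for h
  proof -
    have "(\<lambda>k. s (r k) * (\<zeta> (r k) \<bullet> h) - (s (r k) *\<^sub>R \<nu> (r k)) \<bullet> \<Phi>' (x (r k)) h)
        \<longlonglongrightarrow> \<sigma> * (\<eta> \<bullet> h) - \<mu> \<bullet> \<Phi>' w h"
      by (intro tendsto_intros \<sigma> \<mu> \<zeta>r isCont_tendsto_compose[OF cont xr])
    moreover have "(\<lambda>k. s (r k) * (\<zeta> (r k) \<bullet> h) - (s (r k) *\<^sub>R \<nu> (r k)) \<bullet> \<Phi>' (x (r k)) h) \<longlonglongrightarrow> 0"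
    proof (rule Lim_null_comparison)
      have "(\<lambda>k. inverse (real (Suc (r k))) * norm h) \<longlonglongrightarrow> 0 * norm h"
        using LIMSEQ_subseq_LIMSEQ[OF LIMSEQ_inverse_real_of_nat r]
        by (intro tendsto_mult_right) (simp add: o_def)
      then show "(\<lambda>k. inverse (real (Suc (r k))) * norm h) \<longlonglongrightarrow> 0"
        by simp
      have "norm (s k * (\<zeta> k \<bullet> h) - (s k *\<^sub>R \<nu> k) \<bullet> \<Phi>' (x k) h) \<le> inverse (real (Suc k)) * norm h" for k
      proof -
        have "norm (s k * (\<zeta> k \<bullet> h) - (s k *\<^sub>R \<nu> k) \<bullet> \<Phi>' (x k) h) = s k * \<bar>\<zeta> k \<bullet> h - \<nu> k \<bullet> \<Phi>' (x k) h\<bar>"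
          using spos[of k] by (simp add: abs_mult right_diff_distrib[symmetric])
        also have "\<dots> \<le> 1 * \<bar>\<zeta> k \<bullet> h - \<nu> k \<bullet> \<Phi>' (x k) h\<bar>"
          using s1[of k] by (intro mult_right_mono) (smt (verit) norm_ge_zero, simp)
        finally show ?thesis
          using err[of k h] by simp
      qed
      then show "\<forall>\<^sub>F k in sequentially. norm (s (r k) * (\<zeta> (r k) \<bullet> h) - (s (r k) *\<^sub>R \<nu> (r k)) \<bullet> \<Phi>' (x (r k)) h)
          \<le> inverse (real (Suc (r k))) * norm h"
        by (intro always_eventually allI)
    qed
    ultimately show ?thesis
      using LIMSEQ_unique by fastforce
  qed
  \<comment> \<open>If \<sigma> were 0, \<mu> would be a unit normal annihilating the range of the
    derivative.\<close>
  have "\<sigma> \<noteq> 0"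
  proof
    assume "\<sigma> = 0"
    then have "\<mu> = 0"
      by (intro CQ[OF \<mu>N]) (simp add: eq[symmetric])
    with \<open>\<sigma> = 0\<close> sum1 show False
      by simp
  qed
  then show thesis
    using conv_normal_scaleR[OF \<mu>N, of "inverse \<sigma>"] \<sigma>0
    by (intro that[of "inverse \<sigma> *\<^sub>R \<mu>"]) (simp_all add: eq[symmetric])
qed

text \<open>The easy inclusion: the vector is already a regular normal, by Taylor expansion, and
  constant sequences make it a limiting one.\<close>

lemma multiplier_limiting_normal_preimage:
  fixes \<Phi> :: "'a::euclidean_space \<Rightarrow> 'b::euclidean_space"
  assumes der: "(\<Phi> has_derivative \<Phi>') (at w)" and w: "\<Phi> w \<in> D"
    and \<nu>: "\<nu> \<in> conv_normal D (\<Phi> w)" and eq: "\<And>h. \<eta> \<bullet> h = \<nu> \<bullet> \<Phi>' h"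
  shows "\<eta> \<in> limiting_normal_cone (\<Phi> -` D) w"
proof -
  have "\<eta> \<in> regular_normal_cone (\<Phi> -` D) w"
    unfolding regular_normal_cone_def
  proof (intro CollectI conjI allI impI)
    fix e :: real assume "e > 0"
    \<comment> \<open>The summand 1 keeps the quotient meaningful when \<nu> = 0.\<close>
    define e' where "e' = e / (1 + norm \<nu>)"
    have pos: "1 + norm \<nu> > 0"
      by (simp add: add_pos_nonneg)
    then have "e' > 0"
      using \<open>e > 0\<close> by (simp add: e'_def)
    then obtain \<delta> where "\<delta> > 0" and \<delta>: "\<And>y. norm (y - w) < \<delta> \<Longrightarrow>
        norm (\<Phi> y - \<Phi> w - \<Phi>' (y - w)) \<le> e' * norm (y - w)"
      using der unfolding has_derivative_at_alt by blast
    show "\<exists>\<delta>>0. \<forall>z'\<in>\<Phi> -` D. norm (z' - w) < \<delta> \<longrightarrow> \<eta> \<bullet> (z' - w) \<le> e * norm (z' - w)"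
    proof (intro exI[of _ \<delta>] conjI ballI impI)
      fix z' assume z': "z' \<in> \<Phi> -` D" "norm (z' - w) < \<delta>"
      have "\<eta> \<bullet> (z' - w) = \<nu> \<bullet> (\<Phi> z' - \<Phi> w) - \<nu> \<bullet> (\<Phi> z' - \<Phi> w - \<Phi>' (z' - w))"
        using eq[of "z' - w"] by (simp add: inner_diff_right)
      also have "\<dots> \<le> 0 + norm \<nu> * norm (\<Phi> z' - \<Phi> w - \<Phi>' (z' - w))"
        using \<nu> z'(1) norm_cauchy_schwarz[of "- \<nu>" "\<Phi> z' - \<Phi> w - \<Phi>' (z' - w)"]
        by (fastforce simp: conv_normal_def)
      also have "\<dots> \<le> (1 + norm \<nu>) * (e' * norm (z' - w))"
        using \<delta>[OF z'(2)] by (auto intro!: mult_mono)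
      also have "\<dots> = e * norm (z' - w)"
        using pos by (simp add: e'_def)
      finally show "\<eta> \<bullet> (z' - w) \<le> e * norm (z' - w)" .
    qed (fact \<open>\<delta> > 0\<close>)
  qed (use w in simp)
  then show ?thesis
    using w unfolding limiting_normal_cone_def
    by (intro CollectI conjI exI[of _ "\<lambda>_. w"] exI[of _ "\<lambda>_. \<eta>"]) auto
qed

section \<open>Chain rule for subdifferentials\<close>

text \<open>The convex subdifferential, quantified over epigraph points so that the inequality
  involves only real numbers.\<close>

definition conv_subdiff :: "('a::euclidean_space \<Rightarrow> ereal) \<Rightarrow> 'a \<Rightarrow> 'a set" where
  "conv_subdiff g z =
     {y. \<bar>g z\<bar> \<noteq> \<infinity> \<and> (\<forall>(z', \<rho>)\<in>epi g. y \<bullet> (z' - z) \<le> \<rho> - real_of_ereal (g z))}"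

lemma lower_semicontD:
  assumes "lower_semicont g" and "c < g z"
  shows "\<forall>\<^sub>F x in nhds z. c < g x"
  using assms unfolding lower_semicont_def le_Liminf_iff eventually_nhds_conv_at by blast

lemma closed_epi:
  fixes g :: "'a::euclidean_space \<Rightarrow> ereal"
  assumes "lower_semicont g"
  shows "closed (epi g)"
proof -
  have "l \<in> epi g" if p: "\<And>n. p n \<in> epi g" and l: "p \<longlonglongrightarrow> l" for p :: "nat \<Rightarrow> 'a \<times> real" and l
  proof -
    have "\<not> ereal (snd l) < g (fst l)"
    proof
      assume "ereal (snd l) < g (fst l)"
      then obtain c where c: "ereal (snd l) < ereal c" "ereal c < g (fst l)"
        using ereal_dense2 by blast
      have "\<forall>\<^sub>F n in sequentially. ereal c < g (fst (p n))"
        using lower_semicontD[OF assms c(2)] tendsto_fst[OF l] by (rule eventually_compose_filterlim)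
      moreover have "\<forall>\<^sub>F n in sequentially. snd (p n) < c"
        using tendsto_snd[OF l] c(1) by (intro order_tendstoD(2)) auto
      ultimately have "\<forall>\<^sub>F n in sequentially. False"
      proof eventually_elim
        case (elim n)
        have "g (fst (p n)) \<le> ereal (snd (p n))"
          using p[of n] by (simp add: epi_def case_prod_beta)
        also have "\<dots> < ereal c"
          using elim by simp
        finally show ?case
          using elim by simp
      qed
      then show False
        by simp
    qed
    then show ?thesis
      by (simp add: epi_def case_prod_beta)
  qed
  then show ?thesis
    unfolding closed_sequential_limits by blast
qed

lemma proper_fun_epi_nonempty:
  assumes "proper_fun g"
  obtains z \<rho> where "(z, \<rho>) \<in> epi g"
proof -
  obtain z where "g z \<noteq> \<infinity>" "g z \<noteq> -\<infinity>"
    using assms unfolding proper_fun_def by blast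
  then have "(z, real_of_ereal (g z)) \<in> epi g"
    by (cases "g z") (auto simp: epi_def)
  then show thesis
    by (rule that)
qed

text \<open>Membership in an epigraph replaces the value of g at z, so limits of subgradients follow
  from closedness of \<open>epi g\<close> with no convergence of function values to establish.
  Properness makes the right-hand side imply finiteness at z.\<close>

lemma conv_subdiff_iff:
  assumes "proper_fun g"
  shows "y \<in> conv_subdiff g z \<longleftrightarrow> (\<forall>(z', \<rho>)\<in>epi g. (z, \<rho> - y \<bullet> (z' - z)) \<in> epi g)"
proof -
  obtain z0 \<rho>0 where e: "(z0, \<rho>0) \<in> epi g"
    using proper_fun_epi_nonempty[OF assms] .
  show ?thesis
  proof (cases "g z")
    case (real r)
    then show ?thesis
      unfolding conv_subdiff_def epi_def by (fastforce simp: algebra_simps)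
  next
    case PInf
    then show ?thesis
      using e unfolding conv_subdiff_def epi_def by fastforce
  next
    case MInf
    then show ?thesis
      using assms unfolding proper_fun_def by blast
  qed
qed

lemma conv_subdiff_convex: "convex (conv_subdiff g z)"
proof (rule convexI)
  fix x y and a b :: real
  assume *: "x \<in> conv_subdiff g z" "y \<in> conv_subdiff g z" "0 \<le> a" "0 \<le> b" "a + b = 1"
  have "(a *\<^sub>R x + b *\<^sub>R y) \<bullet> (z' - z) \<le> \<rho> - real_of_ereal (g z)" if "(z', \<rho>) \<in> epi g" for z' \<rho>
  proof -
    have "a * (x \<bullet> (z' - z)) + b * (y \<bullet> (z' - z)) \<le> \<rho> - real_of_ereal (g z)"
      using * that unfolding conv_subdiff_def by (intro convex_bound_le) auto
    then show ?thesis
      by (simp add: inner_add_left)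
  qed
  then show "a *\<^sub>R x + b *\<^sub>R y \<in> conv_subdiff g z"
    using *(1) unfolding conv_subdiff_def by auto
qed

lemma conv_normal_epi_iff:
  assumes "\<bar>g z\<bar> \<noteq> \<infinity>"
  shows "(y, -1) \<in> conv_normal (epi g) (z, real_of_ereal (g z)) \<longleftrightarrow> y \<in> conv_subdiff g z"
  using assms unfolding conv_normal_def conv_subdiff_def by (auto simp: algebra_simps)

text \<open>Abstracts the form shared by f and f(.,u), so that one chain rule can be instantiated
  for the joint and for the partial function.\<close>

locale smooth_composition =
  fixes h :: "'w::euclidean_space \<Rightarrow> ereal" and a :: "'w \<Rightarrow> real"
    and A :: "'w \<Rightarrow> 'b::euclidean_space" and g :: "'b \<Rightarrow> ereal"
    and a' :: "'w \<Rightarrow> 'w \<Rightarrow> real" and A' :: "'w \<Rightarrow> 'w \<Rightarrow> 'b"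
  assumes h: "\<And>w. h w = ereal (a w) + g (A w)"
    and a': "\<And>w. (a has_derivative a' w) (at w)"
    and A': "\<And>w. (A has_derivative A' w) (at w)"
    and cont_a': "\<And>w k. isCont (\<lambda>w. a' w k) w"
    and cont_A': "\<And>w k. isCont (\<lambda>w. A' w k) w"
    and g: "proper_fun g" "lower_semicont g" "convex_fun g"
begin

text \<open>Subtracting a(w) from the height absorbs the smooth summand, so that the epigraph of h
  is a plain preimage of \<open>epi g\<close>.\<close>

definition "\<Psi> = (\<lambda>(w, r). (A w, r - a w))"
definition "\<Psi>' = (\<lambda>(w, r :: real) (k, s). (A' w k, s - a' w k))"

lemma epi_eq: "epi h = \<Psi> -` epi g"
proof -
  have "h w \<le> ereal r \<longleftrightarrow> g (A w) \<le> ereal (r - a w)" for w r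
    unfolding h by (cases "g (A w)") (auto simp: algebra_simps)
  then show ?thesis
    by (auto simp: epi_def \<Psi>_def)
qed

lemma \<Psi>': "(\<Psi> has_derivative \<Psi>' p) (at p)"
proof -
  have "((\<lambda>p. (A (fst p), snd p - a (fst p))) has_derivative
      (\<lambda>k. (A' (fst p) (fst k), snd k - a' (fst p) (fst k)))) (at p)"
    by (intro has_derivative_Pair has_derivative_diff has_derivative_snd has_derivative_ident
        has_derivative_compose[OF has_derivative_fst[OF has_derivative_ident] A']
        has_derivative_compose[OF has_derivative_fst[OF has_derivative_ident] a'])
  then show ?thesis
    by (simp add: \<Psi>_def \<Psi>'_def case_prod_beta')
qed

lemma cont_\<Psi>': "isCont (\<lambda>p. \<Psi>' p k) p"
proof -
  have "isCont (\<lambda>p. (A' (fst p) (fst k), snd k - a' (fst p) (fst k))) p"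
    by (intro continuous_Pair continuous_diff continuous_const
        isCont_o2[OF _ cont_A'] isCont_o2[OF _ cont_a'] isCont_fst continuous_ident)
  then show ?thesis
    by (simp add: \<Psi>'_def case_prod_beta')
qed

lemma \<Psi>_value:
  assumes "\<bar>g (A w)\<bar> \<noteq> \<infinity>"
  shows "\<Psi> (w, real_of_ereal (h w)) = (A w, real_of_ereal (g (A w)))"
  using assms by (cases "g (A w)") (auto simp: \<Psi>_def h)

text \<open>The adjoint of the derivative of \<Psi> sends the normal (y,-1) of \<open>epi g\<close>
  to (\<zeta>,-1), the entry -1 contributing the gradient of a.\<close>

lemma conv_subdiff_imp_lim_subdiff:
  assumes y: "y \<in> conv_subdiff g (A w)" and eq: "\<And>k. \<zeta> \<bullet> k = a' w k + y \<bullet> A' w k"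
  shows "\<zeta> \<in> lim_subdiff h w"
proof -
  have fin: "\<bar>g (A w)\<bar> \<noteq> \<infinity>"
    using y by (simp add: conv_subdiff_def)
  have "(\<zeta>, -1) \<in> limiting_normal_cone (epi h) (w, real_of_ereal (h w))"
    unfolding epi_eq
  proof (rule multiplier_limiting_normal_preimage[OF \<Psi>'])
    show "\<Psi> (w, real_of_ereal (h w)) \<in> epi g"
      unfolding \<Psi>_value[OF fin] using fin by (auto simp: epi_def ereal_real)
    show "(y, -1) \<in> conv_normal (epi g) (\<Psi> (w, real_of_ereal (h w)))"
      unfolding \<Psi>_value[OF fin] conv_normal_epi_iff[of g "A w", OF fin] by (rule y)
    show "(\<zeta>, -1) \<bullet> k = (y, -1) \<bullet> \<Psi>' (w, real_of_ereal (h w)) k" for k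
      by (cases k) (simp add: \<Psi>'_def eq)
  qed
  moreover have "\<bar>h w\<bar> \<noteq> \<infinity>"
    using fin unfolding h by (cases "g (A w)") auto
  ultimately show ?thesis
    by (simp add: lim_subdiff_def)
qed

text \<open>A normal of \<open>epi g\<close> annihilated by the adjoint of the derivative has height
  component 0, so the qualification for \<Psi> reduces to one on horizontal normals, that is,
  normals to dom g.\<close>

lemma lim_subdiff_imp_conv_subdiff:
  assumes \<zeta>: "\<zeta> \<in> lim_subdiff h w"
    and CQ: "\<And>y. (\<And>k. y \<bullet> A' w k = 0) \<Longrightarrow> (\<And>z \<rho>. (z, \<rho>) \<in> epi g \<Longrightarrow> y \<bullet> (z - A w) \<le> 0) \<Longrightarrow> y = 0"
  obtains y where "y \<in> conv_subdiff g (A w)" and "\<And>k. \<zeta> \<bullet> k = a' w k + y \<bullet> A' w k"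
proof -
  have fin: "\<bar>g (A w)\<bar> \<noteq> \<infinity>"
    using \<zeta> unfolding lim_subdiff_def h by (cases "g (A w)") auto
  have lin: "a' w 0 = 0" "A' w 0 = 0"
    using linear_0[OF has_derivative_linear[OF a']] linear_0[OF has_derivative_linear[OF A']] .
  obtain \<nu> where \<nu>: "\<nu> \<in> conv_normal (epi g) (\<Psi> (w, real_of_ereal (h w)))"
    and eq: "\<And>k. (\<zeta>, -1) \<bullet> k = \<nu> \<bullet> \<Psi>' (w, real_of_ereal (h w)) k"
  proof (rule limiting_normal_preimage_multiplier[OF closed_epi[OF g(2)] _ \<Psi>' cont_\<Psi>'])
    show "convex (epi g)"
      using g(3) by (simp add: convex_fun_def)
    show "(\<zeta>, -1) \<in> limiting_normal_cone (\<Psi> -` epi g) (w, real_of_ereal (h w))"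
      using \<zeta> unfolding epi_eq[symmetric] by (simp add: lim_subdiff_def)
  next
    fix \<mu> :: "'b \<times> real"
    assume \<mu>: "\<mu> \<in> conv_normal (epi g) (\<Psi> (w, real_of_ereal (h w)))"
      and 0: "\<And>k. \<mu> \<bullet> \<Psi>' (w, real_of_ereal (h w)) k = 0"
    obtain y s where ys: "\<mu> = (y, s)"
      by (cases \<mu>)
    \<comment> \<open>The direction (0,1) moves the height alone and isolates s; below, the same
      direction identifies the height component -1.\<close>
    have "s = 0"
      using 0[of "(0, 1)"] by (simp add: ys \<Psi>'_def lin)
    then have "y = 0"
    proof (intro CQ)
      show "y \<bullet> A' w k = 0" for k
        using 0[of "(k, 0)"] \<open>s = 0\<close> by (simp add: ys \<Psi>'_def)
      show "y \<bullet> (z - A w) \<le> 0" if "(z, \<rho>) \<in> epi g" for z \<rho>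
        using \<mu> that \<open>s = 0\<close> unfolding conv_normal_def ys \<Psi>_value[OF fin] by fastforce
    qed
    then show "\<mu> = 0"
      using ys \<open>s = 0\<close> by (simp add: zero_prod_def)
  qed (rule that)
  obtain y s where ys: "\<nu> = (y, s)"
    by (cases \<nu>)
  have s: "s = -1"
    using eq[of "(0, 1)"] by (simp add: ys \<Psi>'_def lin)
  show thesis
  proof (rule that)
    show "y \<in> conv_subdiff g (A w)"
      using \<nu> unfolding ys s \<Psi>_value[OF fin] conv_normal_epi_iff[of g "A w", OF fin] .
    show "\<zeta> \<bullet> k = a' w k + y \<bullet> A' w k" for k
      using eq[of "(k, 0)"] by (simp add: ys s \<Psi>'_def)
  qed
qed

end

text \<open>Connects (BQ), phrased with the singular subdifferential, to the qualification on convex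
  normals used by the multiplier rule; the preimage lemma is applied to the identity map.\<close>

lemma conv_normal_imp_sing_subdiff:
  assumes fin: "\<bar>g z\<bar> \<noteq> \<infinity>" and y: "\<And>z' \<rho>. (z', \<rho>) \<in> epi g \<Longrightarrow> y \<bullet> (z' - z) \<le> 0"
  shows "y \<in> sing_subdiff g z"
proof -
  have "(y, 0) \<in> limiting_normal_cone (id -` epi g) (z, real_of_ereal (g z))"
  proof (rule multiplier_limiting_normal_preimage)
    show "(id has_derivative (\<lambda>k. k)) (at (z, real_of_ereal (g z)))"
      unfolding id_def by (rule has_derivative_ident)
    show "id (z, real_of_ereal (g z)) \<in> epi g"
      using fin by (auto simp: epi_def ereal_real)
    show "(y, 0) \<in> conv_normal (epi g) (id (z, real_of_ereal (g z)))"
      using y by (auto simp: conv_normal_def)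
  qed simp
  then show ?thesis
    using fin by (simp add: sing_subdiff_def)
qed

section \<open>The composite form\<close>

lemma twice_cont_diff_imp_C1:
  assumes "twice_cont_diff h"
  obtains h' where "\<And>x. (h has_derivative h' x) (at x)" and "\<And>x k. isCont (\<lambda>x. h' x k) x"
proof -
  obtain h' h'' where h': "\<And>x. (h has_derivative blinfun_apply (h' x)) (at x)"
    and h'': "\<And>x. (h' has_derivative blinfun_apply (h'' x)) (at x)"
    using assms unfolding twice_cont_diff_def by blast
  have "isCont (\<lambda>x. blinfun_apply (h' x) k) x" for x k
    using has_derivative_continuous[OF h''[of x]] by (intro continuous_intros)
  with h' show thesis
    by (rule that)
qed

locale composite =
  fixes f :: "'a::euclidean_space \<times> 'b::euclidean_space \<Rightarrow> ereal" and f0 :: "'a \<Rightarrow> real"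
    and F :: "'a \<Rightarrow> 'b" and g :: "'b \<Rightarrow> ereal"
    and f0' :: "'a \<Rightarrow> 'a \<Rightarrow> real" and F' :: "'a \<Rightarrow> 'a \<Rightarrow> 'b"
  assumes f: "\<And>x u. f (x, u) = ereal (f0 x) + g (F x + u)"
    and f0': "\<And>x. (f0 has_derivative f0' x) (at x)"
    and F': "\<And>x. (F has_derivative F' x) (at x)"
    and cont_f0': "\<And>x k. isCont (\<lambda>x. f0' x k) x"
    and cont_F': "\<And>x k. isCont (\<lambda>x. F' x k) x"
    and g: "proper_fun g" "lower_semicont g" "convex_fun g"
begin

section \<open>The joint and partial functions; properties (A) and (B)\<close>

sublocale joint: smooth_composition f "\<lambda>w. f0 (fst w)" "\<lambda>w. F (fst w) + snd w" g
  "\<lambda>w k. f0' (fst w) (fst k)" "\<lambda>w k. F' (fst w) (fst k) + snd k"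
proof
  fix w k :: "'a \<times> 'b"
  show "f w = ereal (f0 (fst w)) + g (F (fst w) + snd w)"
    by (cases w) (simp add: f)
  show "((\<lambda>w. f0 (fst w)) has_derivative (\<lambda>k. f0' (fst w) (fst k))) (at w)"
    by (intro has_derivative_compose[OF has_derivative_fst[OF has_derivative_ident] f0'])
  show "((\<lambda>w. F (fst w) + snd w) has_derivative (\<lambda>k. F' (fst w) (fst k) + snd k)) (at w)"
    by (intro has_derivative_add has_derivative_snd has_derivative_ident
        has_derivative_compose[OF has_derivative_fst[OF has_derivative_ident] F'])
  show "isCont (\<lambda>w. f0' (fst w) (fst k)) w"
    by (intro isCont_o2[OF _ cont_f0'] isCont_fst continuous_ident)
  show "isCont (\<lambda>w. F' (fst w) (fst k) + snd k) w"
    by (intro continuous_add continuous_const isCont_o2[OF _ cont_F'] isCont_fst continuous_ident)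
qed (fact g)+

sublocale partial: smooth_composition "\<lambda>x. f (x, u)" f0 "\<lambda>x. F x + u" g f0' F' for u
proof
  show "((\<lambda>x. F x + u) has_derivative F' w) (at w)" for w
    using has_derivative_add[OF F' has_derivative_const] by simp
qed (fact f f0' cont_f0' cont_F' g)+

text \<open>The inner map (x,u) to F(x) + u has a surjective derivative, so the qualification
  condition holds automatically. Directions (0,k) identify the multiplier with y, directions (k,0)
  give the equation for v.\<close>

lemma lim_subdiff_iff:
  "(v, y) \<in> lim_subdiff f (x, u) \<longleftrightarrow>
    y \<in> conv_subdiff g (F x + u) \<and> (\<forall>k. v \<bullet> k = f0' x k + y \<bullet> F' x k)"
proof
  have lin: "f0' x 0 = 0" "F' x 0 = 0"
    using linear_0[OF has_derivative_linear[OF f0']] linear_0[OF has_derivative_linear[OF F']] .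
  assume "(v, y) \<in> lim_subdiff f (x, u)"
  then obtain y' where y': "y' \<in> conv_subdiff g (F (fst (x, u)) + snd (x, u))"
    and eq: "\<And>k. (v, y) \<bullet> k = f0' (fst (x, u)) (fst k) + y' \<bullet> (F' (fst (x, u)) (fst k) + snd k)"
  proof (rule joint.lim_subdiff_imp_conv_subdiff)
    fix z assume "\<And>k :: 'a \<times> 'b. z \<bullet> (F' (fst (x, u)) (fst k) + snd k) = 0"
    from this[of "(0, z)"] show "z = 0"
      by (simp add: lin)
  qed (rule that)
  have "y \<bullet> k = y' \<bullet> k" for k
    using eq[of "(0, k)"] by (simp add: lin)
  then have "y = y'"
    using vector_eq_rdot by blast
  moreover have "v \<bullet> k = f0' x k + y' \<bullet> F' x k" for k
    using eq[of "(k, 0)"] by simp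
  ultimately show "y \<in> conv_subdiff g (F x + u) \<and> (\<forall>k. v \<bullet> k = f0' x k + y \<bullet> F' x k)"
    using y' by simp
next
  assume "y \<in> conv_subdiff g (F x + u) \<and> (\<forall>k. v \<bullet> k = f0' x k + y \<bullet> F' x k)"
  then show "(v, y) \<in> lim_subdiff f (x, u)"
    by (intro joint.conv_subdiff_imp_lim_subdiff[of y]) (auto simp: inner_add_right)
qed

lemma lim_subdiff_imp_subdiff_x:
  assumes "(v, y) \<in> lim_subdiff f (x, u)"
  shows "v \<in> subdiff_x f x u"
  using assms unfolding lim_subdiff_iff subdiff_x_def
  by (intro partial.conv_subdiff_imp_lim_subdiff[of y]) auto

text \<open>Y(v,u,x) is the convex subdifferential cut by one hyperplane for each direction
  k.\<close>

lemma prop_A: "prop_A f"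
proof -
  have "convex {y. (v, y) \<in> lim_subdiff f (x, u)}" for v x u
  proof -
    have "convex {y. v \<bullet> k = f0' x k + y \<bullet> F' x k}" for k
    proof -
      have "{y. v \<bullet> k = f0' x k + y \<bullet> F' x k} = {y. F' x k \<bullet> y = v \<bullet> k - f0' x k}"
        by (auto simp: inner_commute)
      then show ?thesis
        by (simp add: convex_hyperplane)
    qed
    then have "convex (conv_subdiff g (F x + u) \<inter> (\<Inter>k. {y. v \<bullet> k = f0' x k + y \<bullet> F' x k}))"
      by (intro convex_Int conv_subdiff_convex convex_INT)
    also have "conv_subdiff g (F x + u) \<inter> (\<Inter>k. {y. v \<bullet> k = f0' x k + y \<bullet> F' x k}) =
        {y. (v, y) \<in> lim_subdiff f (x, u)}"
      by (auto simp: lim_subdiff_iff)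
    finally show ?thesis .
  qed
  then show ?thesis
    unfolding prop_A_def sv_dom_def map_Y_def using lim_subdiff_imp_subdiff_x by auto
qed

lemma isCont_F: "isCont F x"
  using F' has_derivative_continuous by blast

lemma prop_B: "prop_B f"
proof -
  have "l \<in> sv_gph (map_Y f)" if p: "\<And>n. p n \<in> sv_gph (map_Y f)" and l: "p \<longlonglongrightarrow> l"
    for p :: "nat \<Rightarrow> ('a \<times> 'b \<times> 'a) \<times> 'b" and l
  proof -
    define v u x y where "v n = fst (fst (p n))" and "u n = fst (snd (fst (p n)))"
      and "x n = snd (snd (fst (p n)))" and "y n = snd (p n)" for n
    obtain vl ul xl yl where leq: "l = ((vl, ul, xl), yl)"
      by (metis prod.collapse)
    have peq: "p n = ((v n, u n, x n), y n)" for n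
      by (simp add: v_def u_def x_def y_def)
    have lims: "v \<longlonglongrightarrow> vl" "u \<longlonglongrightarrow> ul" "x \<longlonglongrightarrow> xl" "y \<longlonglongrightarrow> yl"
      using tendsto_fst[OF tendsto_fst[OF l]] tendsto_fst[OF tendsto_snd[OF tendsto_fst[OF l]]]
        tendsto_snd[OF tendsto_snd[OF tendsto_fst[OF l]]] tendsto_snd[OF l]
      by (simp_all add: peq leq)
    note Fx = isCont_tendsto_compose[OF isCont_F lims(3)]
    have mem: "y n \<in> conv_subdiff g (F (x n) + u n)" "v n \<bullet> k = f0' (x n) k + y n \<bullet> F' (x n) k" for n k
      using p[of n] unfolding peq sv_gph_def map_Y_def by (auto simp: lim_subdiff_iff)
    \<comment> \<open>The subgradient inequality is carried to the limit as membership in the closed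
      set \<open>epi g\<close>.\<close>
    have "(F xl + ul, \<rho> - yl \<bullet> (z - (F xl + ul))) \<in> epi g" if "(z, \<rho>) \<in> epi g" for z \<rho>
    proof (rule closed_sequentially[OF closed_epi[OF g(2)]])
      show "(F (x n) + u n, \<rho> - y n \<bullet> (z - (F (x n) + u n))) \<in> epi g" for n
        using mem(1)[of n] that unfolding conv_subdiff_iff[OF g(1)] by blast
      show "(\<lambda>n. (F (x n) + u n, \<rho> - y n \<bullet> (z - (F (x n) + u n))))
          \<longlonglongrightarrow> (F xl + ul, \<rho> - yl \<bullet> (z - (F xl + ul)))"
        by (intro tendsto_intros lims Fx)
    qed
    then have "yl \<in> conv_subdiff g (F xl + ul)"
      unfolding conv_subdiff_iff[OF g(1)] by blast
    moreover have "vl \<bullet> k = f0' xl k + yl \<bullet> F' xl k" for k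
    proof (rule LIMSEQ_unique)
      show "(\<lambda>n. v n \<bullet> k) \<longlonglongrightarrow> vl \<bullet> k"
        by (intro tendsto_intros lims)
      show "(\<lambda>n. v n \<bullet> k) \<longlonglongrightarrow> f0' xl k + yl \<bullet> F' xl k"
        unfolding mem(2)
        by (intro tendsto_intros lims isCont_tendsto_compose[OF cont_f0' lims(3)]
            isCont_tendsto_compose[OF cont_F' lims(3)])
    qed
    ultimately show ?thesis
      unfolding leq sv_gph_def map_Y_def by (simp add: lim_subdiff_iff)
  qed
  then show ?thesis
    unfolding prop_B_def closed_sequential_limits by blast
qed

section \<open>Local multiplier bounds; properties (C) and (D)\<close>

text \<open>
  The choice \<open>s = 1\<close> covers subgradients and \<open>s = 0\<close> horizon subgradients; the slack \<open>\<bar>\<rho>\<bar> + c\<close>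
  absorbs a local lower bound of \<open>g\<close>.
\<close>

lemma multiplier_bound:
  assumes CQ: "\<forall>y. (\<forall>k. y \<bullet> F' xb k = 0) \<and> (\<forall>(z, \<rho>)\<in>epi g. y \<bullet> (z - F xb) \<le> 0) \<longrightarrow> y = 0"
    and c: "c \<ge> 0"
  shows "\<exists>r>0. \<exists>K. \<forall>x u y s. dist x xb < r \<and> norm u < r \<and> 0 \<le> s \<and> s \<le> 1 \<and>
      (\<forall>(z, \<rho>)\<in>epi g. y \<bullet> (z - (F x + u)) \<le> \<bar>\<rho>\<bar> + c) \<and>
      (\<forall>k. \<bar>y \<bullet> F' x k + s * f0' x k\<bar> \<le> c * norm k) \<longrightarrow> norm y \<le> K"
proof (rule ccontr)
  let ?H = "\<lambda>r x u y s. dist x xb < r \<and> norm u < r \<and> 0 \<le> s \<and> s \<le> 1 \<and>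
      (\<forall>(z, \<rho>)\<in>epi g. y \<bullet> (z - (F x + u)) \<le> \<bar>\<rho>\<bar> + c) \<and>
      (\<forall>k. \<bar>y \<bullet> F' x k + s * f0' x k\<bar> \<le> c * norm k)"
  assume neg: "\<not> (\<exists>r>0. \<exists>K. \<forall>x u y s. ?H r x u y s \<longrightarrow> norm y \<le> K)"
  have "\<exists>x u y s. ?H (inverse (real (Suc n))) x u y s \<and> norm y > real (Suc n)" for n
  proof (rule ccontr)
    assume "\<not> ?thesis"
    then have "\<forall>x u y s. ?H (inverse (real (Suc n))) x u y s \<longrightarrow> norm y \<le> real (Suc n)"
      by (blast intro: leI)
    moreover have "inverse (real (Suc n)) > 0"
      by simp
    ultimately show False
      using neg by blast
  qed
  then obtain x u y s where x: "\<And>n. dist (x n) xb < inverse (real (Suc n))"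
    and u: "\<And>n. norm (u n) < inverse (real (Suc n))" and s: "\<And>n. 0 \<le> s n" "\<And>n. s n \<le> 1"
    and N: "\<And>n. \<forall>(z, \<rho>)\<in>epi g. y n \<bullet> (z - (F (x n) + u n)) \<le> \<bar>\<rho>\<bar> + c"
    and adj: "\<And>n k. \<bar>y n \<bullet> F' (x n) k + s n * f0' (x n) k\<bar> \<le> c * norm k"
    and large: "\<And>n. norm (y n) > real (Suc n)"
    by metis
  have ypos: "norm (y n) > 0" for n
    using large[of n] by (rule le_less_trans[rotated]) simp
  \<comment> \<open>Multiplying by \<tau> turns y into a unit vector and sends the slack |\<rho>| +
    c, the error c|k| and the f0-term to 0; the limit is a unit vector violating
    \<open>CQ\<close>.\<close>
  define \<tau> where "\<tau> n = inverse (norm (y n))" for n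
  have \<tau>pos: "\<tau> n > 0" for n
    using ypos[of n] by (simp add: \<tau>_def)
  have "\<tau> n < inverse (real (Suc n))" for n
    unfolding \<tau>_def using large[of n] by (intro less_imp_inverse_less) auto
  then have \<tau>0: "\<tau> \<longlonglongrightarrow> 0"
    using \<tau>pos by (intro tendsto_inverse_Suc) (simp add: dist_norm abs_of_pos del: of_nat_Suc)
  define e where "e n = \<tau> n *\<^sub>R y n" for n
  have en: "norm (e n) = 1" for n
    using ypos[of n] by (simp add: e_def \<tau>_def)
  have "bounded (range e)"
    by (rule boundedI[of _ 1]) (auto simp: en)
  then obtain r l where r: "strict_mono (r :: nat \<Rightarrow> nat)" and l: "(e \<circ> r) \<longlonglongrightarrow> l"
    using bounded_imp_convergent_subsequence by blast
  have er: "(\<lambda>n. e (r n)) \<longlonglongrightarrow> l"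
    using l by (simp add: o_def)
  have \<tau>r: "(\<lambda>n. \<tau> (r n)) \<longlonglongrightarrow> 0"
    using LIMSEQ_subseq_LIMSEQ[OF \<tau>0 r] by (simp add: o_def)
  have "x \<longlonglongrightarrow> xb"
    using x by (rule tendsto_inverse_Suc)
  from LIMSEQ_subseq_LIMSEQ[OF this r] have xr: "(\<lambda>n. x (r n)) \<longlonglongrightarrow> xb"
    by (simp add: o_def)
  have "u \<longlonglongrightarrow> 0"
    using u by (intro tendsto_inverse_Suc) (simp add: dist_norm del: of_nat_Suc)
  from LIMSEQ_subseq_LIMSEQ[OF this r] have ur: "(\<lambda>n. u (r n)) \<longlonglongrightarrow> 0"
    by (simp add: o_def)
  have "l \<bullet> (z - F xb) \<le> 0" if z: "(z, \<rho>) \<in> epi g" for z \<rho>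
  proof -
    have "l \<bullet> (z - (F xb + 0)) \<le> 0 * (\<bar>\<rho>\<bar> + c)"
    proof (rule LIMSEQ_le)
      show "(\<lambda>n. e (r n) \<bullet> (z - (F (x (r n)) + u (r n)))) \<longlonglongrightarrow> l \<bullet> (z - (F xb + 0))"
        by (intro tendsto_intros er ur isCont_tendsto_compose[OF isCont_F xr])
      show "(\<lambda>n. \<tau> (r n) * (\<bar>\<rho>\<bar> + c)) \<longlonglongrightarrow> 0 * (\<bar>\<rho>\<bar> + c)"
        by (intro tendsto_intros \<tau>r)
      have "e n \<bullet> (z - (F (x n) + u n)) \<le> \<tau> n * (\<bar>\<rho>\<bar> + c)" for n
        using N[of n] z \<tau>pos[of n] unfolding e_def inner_scaleR_left
        by (intro mult_left_mono) auto
      then show "\<exists>N. \<forall>n\<ge>N. e (r n) \<bullet> (z - (F (x (r n)) + u (r n))) \<le> \<tau> (r n) * (\<bar>\<rho>\<bar> + c)"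
        by blast
    qed
    then show ?thesis
      by simp
  qed
  moreover have "l \<bullet> F' xb k = 0" for k
  proof -
    have \<tau>s: "(\<lambda>n. \<tau> (r n) * s (r n)) \<longlonglongrightarrow> 0"
    proof (rule Lim_null_comparison[OF _ \<tau>r])
      have "norm (\<tau> n * s n) \<le> \<tau> n" for n
        using s[of n] \<tau>pos[of n] by (simp add: abs_mult mult_le_cancel_left1)
      then show "\<forall>\<^sub>F n in sequentially. norm (\<tau> (r n) * s (r n)) \<le> \<tau> (r n)"
        by (intro always_eventually allI)
    qed
    have "(\<lambda>n. e (r n) \<bullet> F' (x (r n)) k + (\<tau> (r n) * s (r n)) * f0' (x (r n)) k)
        \<longlonglongrightarrow> l \<bullet> F' xb k + 0 * f0' xb k"
      by (intro tendsto_intros er \<tau>s isCont_tendsto_compose[OF cont_f0' xr]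
          isCont_tendsto_compose[OF cont_F' xr])
    moreover have "(\<lambda>n. e (r n) \<bullet> F' (x (r n)) k + (\<tau> (r n) * s (r n)) * f0' (x (r n)) k) \<longlonglongrightarrow> 0"
    proof (rule Lim_null_comparison)
      show "(\<lambda>n. \<tau> (r n) * (c * norm k)) \<longlonglongrightarrow> 0"
        using tendsto_mult_right[OF \<tau>r, of "c * norm k"] by simp
      have "norm (e n \<bullet> F' (x n) k + (\<tau> n * s n) * f0' (x n) k) \<le> \<tau> n * (c * norm k)" for n
      proof -
        have "e n \<bullet> F' (x n) k + (\<tau> n * s n) * f0' (x n) k = \<tau> n * (y n \<bullet> F' (x n) k + s n * f0' (x n) k)"
          by (simp add: e_def algebra_simps)
        then show ?thesis
          using mult_left_mono[OF adj[of n k] less_imp_le[OF \<tau>pos[of n]]] \<tau>pos[of n]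
          by (simp add: abs_mult)
      qed
      then show "\<forall>\<^sub>F n in sequentially. norm (e (r n) \<bullet> F' (x (r n)) k + (\<tau> (r n) * s (r n)) * f0' (x (r n)) k)
          \<le> \<tau> (r n) * (c * norm k)"
        by (intro always_eventually allI)
    qed
    ultimately show ?thesis
      using LIMSEQ_unique by fastforce
  qed
  ultimately have "l = 0"
    using CQ by blast
  moreover have "norm l = 1"
    using tendsto_norm[OF er] by (simp add: en LIMSEQ_const_iff)
  ultimately show False
    by simp
qed

text \<open>Both conclusions come from a single multiplier bound: with s = 1 it bounds Y locally,
  with s = 0 it bounds a cone, which must then be {0}. The second conclusion carries the
  qualification from the reference point to its neighbourhood.\<close>

lemma local_bound_and_qualification:
  assumes fin: "\<bar>g (F xb)\<bar> \<noteq> \<infinity>"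
    and CQ: "\<forall>y. (\<forall>k. y \<bullet> F' xb k = 0) \<and> (\<forall>(z, \<rho>)\<in>epi g. y \<bullet> (z - F xb) \<le> 0) \<longrightarrow> y = 0"
  shows "\<exists>r>0. \<exists>K.
      (\<forall>v u x y. norm v < r \<and> norm u < r \<and> dist x xb < r \<and> (v, y) \<in> lim_subdiff f (x, u) \<longrightarrow>
        norm y \<le> K) \<and>
      (\<forall>u x y. norm u < r \<and> dist x xb < r \<and> (\<forall>k. y \<bullet> F' x k = 0) \<and>
        (\<forall>(z, \<rho>)\<in>epi g. y \<bullet> (z - (F x + u)) \<le> 0) \<longrightarrow> y = 0)"
proof -
  \<comment> \<open>A number below g(F xb); lower semicontinuity keeps it below g nearby, so \<rho>
    - g(F x + u) is at most |\<rho>| + |c0|.\<close>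
  obtain c0 where c0: "ereal c0 < g (F xb)"
    using fin ereal_dense2[of "-\<infinity>" "g (F xb)"] by (cases "g (F xb)") auto
  have "\<forall>\<^sub>F p in nhds (xb, 0). ereal c0 < g (F (fst p) + snd p)"
  proof (rule eventually_compose_filterlim[OF lower_semicontD[OF g(2) c0]])
    define G where "G p = F (fst p) + snd p" for p
    have "isCont G (xb, 0)"
      unfolding G_def[abs_def] by (intro continuous_add isCont_o2[OF _ isCont_F] isCont_fst isCont_snd continuous_ident)
    from this[unfolded isCont_def tendsto_at_iff_tendsto_nhds]
    show "filterlim (\<lambda>p. F (fst p) + snd p) (nhds (F xb)) (nhds (xb, 0))"
      by (simp add: G_def[abs_def])
  qed
  then obtain d where "d > 0" and d: "\<And>p. dist p (xb, 0) < d \<Longrightarrow> ereal c0 < g (F (fst p) + snd p)"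
    unfolding eventually_nhds_metric by blast
  \<comment> \<open>One constant covers both slacks: |c0| for the lower bound of g, and 1 for
    |v|.\<close>
  have "1 + \<bar>c0\<bar> \<ge> 0"
    by simp
  from multiplier_bound[OF CQ this] obtain r K where "r > 0"
    and rK: "\<And>x u y s. dist x xb < r \<Longrightarrow> norm u < r \<Longrightarrow> 0 \<le> s \<Longrightarrow> s \<le> 1 \<Longrightarrow>
      \<forall>(z, \<rho>)\<in>epi g. y \<bullet> (z - (F x + u)) \<le> \<bar>\<rho>\<bar> + (1 + \<bar>c0\<bar>) \<Longrightarrow>
      \<forall>k. \<bar>y \<bullet> F' x k + s * f0' x k\<bar> \<le> (1 + \<bar>c0\<bar>) * norm k \<Longrightarrow> norm y \<le> K"
    by blast
  \<comment> \<open>The entry 1 bounds |v|; d/2 is taken because the distance in the product is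
    estimated by the sum of the two distances.\<close>
  define r' where "r' = min 1 (min r (d / 2))"
  have "r' > 0"
    using \<open>r > 0\<close> \<open>d > 0\<close> by (simp add: r'_def)
  moreover have "norm y \<le> K"
    if v: "norm v < r'" and u: "norm u < r'" and x: "dist x xb < r'"
      and vy: "(v, y) \<in> lim_subdiff f (x, u)" for v u x y
  proof -
    have y: "y \<in> conv_subdiff g (F x + u)" and eq: "v \<bullet> k = f0' x k + y \<bullet> F' x k" for k
      using vy by (auto simp: lim_subdiff_iff)
    have "dist (x, u) (xb, 0) \<le> dist x xb + dist u 0"
      unfolding dist_prod_def by (simp add: sqrt_sum_squares_le_sum)
    then have "ereal c0 < g (F x + u)"
      using d[of "(x, u)"] u x by (simp add: r'_def)
    then have c0le: "c0 \<le> real_of_ereal (g (F x + u))"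
      using y unfolding conv_subdiff_def by (cases "g (F x + u)") auto
    show ?thesis
    proof (rule rK[of x u 1])
      have "y \<bullet> (z - (F x + u)) \<le> \<bar>\<rho>\<bar> + (1 + \<bar>c0\<bar>)" if "(z, \<rho>) \<in> epi g" for z \<rho>
      proof -
        have "y \<bullet> (z - (F x + u)) \<le> \<rho> - real_of_ereal (g (F x + u))"
          using y that unfolding conv_subdiff_def by blast
        then show ?thesis
          using c0le by linarith
      qed
      then show "\<forall>(z, \<rho>)\<in>epi g. y \<bullet> (z - (F x + u)) \<le> \<bar>\<rho>\<bar> + (1 + \<bar>c0\<bar>)"
        by blast
      have "\<bar>y \<bullet> F' x k + 1 * f0' x k\<bar> \<le> (1 + \<bar>c0\<bar>) * norm k" for k
      proof -
        have "\<bar>y \<bullet> F' x k + 1 * f0' x k\<bar> = \<bar>v \<bullet> k\<bar>"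
        by (simp add: eq)
      also have "\<dots> \<le> norm v * norm k"
        by (rule Cauchy_Schwarz_ineq2)
      also have "\<dots> \<le> (1 + \<bar>c0\<bar>) * norm k"
        using v by (intro mult_right_mono) (auto simp: r'_def)
        finally show ?thesis .
      qed
      then show "\<forall>k. \<bar>y \<bullet> F' x k + 1 * f0' x k\<bar> \<le> (1 + \<bar>c0\<bar>) * norm k" ..
    qed (use u x in \<open>auto simp: r'_def\<close>)
  qed
  moreover have "y = 0"
    if u: "norm u < r'" and x: "dist x xb < r'" and k: "\<forall>k. y \<bullet> F' x k = 0"
      and N: "\<forall>(z, \<rho>)\<in>epi g. y \<bullet> (z - (F x + u)) \<le> 0" for u x y
  proof -
    have le: "norm (t *\<^sub>R y) \<le> K" if "t \<ge> 0" for t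
    proof (rule rK[of x u 0])
      have "t * (y \<bullet> (z - (F x + u))) \<le> \<bar>\<rho>\<bar> + (1 + \<bar>c0\<bar>)" if "(z, \<rho>) \<in> epi g" for z \<rho>
      proof -
        have "t * (y \<bullet> (z - (F x + u))) \<le> 0"
          using N that \<open>t \<ge> 0\<close> by (intro mult_nonneg_nonpos) auto
        then show ?thesis
          by linarith
      qed
      then show "\<forall>(z, \<rho>)\<in>epi g. t *\<^sub>R y \<bullet> (z - (F x + u)) \<le> \<bar>\<rho>\<bar> + (1 + \<bar>c0\<bar>)"
        by auto
    qed (use u x k in \<open>auto simp: r'_def\<close>)
    show "y = 0"
    proof (rule ccontr)
      assume "y \<noteq> 0"
      then show False
        \<comment> \<open>This multiple of y has norm |K| + 1, which exceeds K.\<close>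
        using le[of "(\<bar>K\<bar> + 1) / norm y"] by simp
    qed
  qed
  ultimately show ?thesis
    by blast
qed

text \<open>The qualification at every point of W yields a multiplier for each partial subgradient,
  hence the equivalence in (C). The bound K gives (D), and it also closes W \<inter> dom Y: a closed
  graph with bounded fibres has a closed projection.\<close>

lemma prop_CD:
  assumes fin: "\<bar>g (F xb)\<bar> \<noteq> \<infinity>"
    and CQ: "\<forall>y. (\<forall>k. y \<bullet> F' xb k = 0) \<and> (\<forall>(z, \<rho>)\<in>epi g. y \<bullet> (z - F xb) \<le> 0) \<longrightarrow> y = 0"
  shows "prop_CD f xb"
proof -
  from local_bound_and_qualification[OF fin CQ] obtain r K where "r > 0"
    and bd: "\<And>v u x y. norm v < r \<Longrightarrow> norm u < r \<Longrightarrow> dist x xb < r \<Longrightarrow>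
      (v, y) \<in> lim_subdiff f (x, u) \<Longrightarrow> norm y \<le> K"
    and qual: "\<And>u x y. norm u < r \<Longrightarrow> dist x xb < r \<Longrightarrow> \<forall>k. y \<bullet> F' x k = 0 \<Longrightarrow>
      \<forall>(z, \<rho>)\<in>epi g. y \<bullet> (z - (F x + u)) \<le> 0 \<Longrightarrow> y = 0"
    by blast
  \<comment> \<open>Half the radius makes the closed balls fit inside the region of strict
    inequalities.\<close>
  define W where "W = cball (0::'a) (r / 2) \<times> cball (0::'b) (r / 2) \<times> cball xb (r / 2)"
  have Wr: "norm v < r" "norm u < r" "dist x xb < r" if "(v, u, x) \<in> W" for v u x
    using that \<open>r > 0\<close> by (auto simp: W_def dist_commute)
  have W: "closed W" "(0, 0, xb) \<in> interior W"
    using \<open>r > 0\<close> by (auto simp: W_def closed_Times interior_Times)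
  have Yle: "norm y \<le> K" if "w \<in> W" "y \<in> map_Y f w" for w y
    using bd[OF Wr, of "fst w" "fst (snd w)" "snd (snd w)"] that by (auto simp: map_Y_def)
  have D: "prop_D f W"
    unfolding prop_D_def using Yle by (auto intro!: boundedI[of _ K])
  have dom: "v \<in> subdiff_x f x u \<longleftrightarrow> (v, u, x) \<in> sv_dom (map_Y f)" if w: "(v, u, x) \<in> W" for v u x
  proof
    assume "v \<in> subdiff_x f x u"
    then obtain y where "y \<in> conv_subdiff g (F x + u)" "\<And>k. v \<bullet> k = f0' x k + y \<bullet> F' x k"
      unfolding subdiff_x_def
    proof (rule partial.lim_subdiff_imp_conv_subdiff)
      fix y assume "\<And>k. y \<bullet> F' x k = 0" "\<And>z \<rho>. (z, \<rho>) \<in> epi g \<Longrightarrow> y \<bullet> (z - (F x + u)) \<le> 0"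
      then show "y = 0"
        by (intro qual[OF Wr(2,3)[OF w]]) auto
    qed (rule that)
    then show "(v, u, x) \<in> sv_dom (map_Y f)"
      unfolding sv_dom_def map_Y_def using lim_subdiff_iff by auto
  qed (use lim_subdiff_imp_subdiff_x in \<open>auto simp: sv_dom_def map_Y_def\<close>)
  have cl: "closed (W \<inter> sv_dom (map_Y f))"
  proof -
    have "l \<in> W \<inter> sv_dom (map_Y f)" if p: "\<And>n. p n \<in> W \<inter> sv_dom (map_Y f)" and l: "p \<longlonglongrightarrow> l"
      for p :: "nat \<Rightarrow> 'a \<times> 'b \<times> 'a" and l
    proof -
      have "\<exists>y. y \<in> map_Y f (p n)" for n
        using p[of n] by (auto simp: sv_dom_def)
      then obtain y where y: "\<And>n. y n \<in> map_Y f (p n)"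
        by metis
      have "bounded (range y)"
        by (intro boundedI[of _ K]) (use y p Yle in blast)
      then obtain s yl where s: "strict_mono (s :: nat \<Rightarrow> nat)" and yl: "(y \<circ> s) \<longlonglongrightarrow> yl"
        using bounded_imp_convergent_subsequence by blast
      have "(\<lambda>n. ((p \<circ> s) n, (y \<circ> s) n)) \<longlonglongrightarrow> (l, yl)"
        by (intro tendsto_Pair yl LIMSEQ_subseq_LIMSEQ[OF l s])
      then have "(l, yl) \<in> sv_gph (map_Y f)"
        by (rule closed_sequentially[OF prop_B[unfolded prop_B_def], rotated])
          (simp add: sv_gph_def y)
      moreover have "l \<in> W"
        by (rule closed_sequentially[OF W(1) _ l]) (use p in auto)
      ultimately show ?thesis
        by (auto simp: sv_gph_def sv_dom_def)
    qed
    then show ?thesis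
      unfolding closed_sequential_limits by blast
  qed
  \<comment> \<open>Reorders ((x,u),v), the layout of the graph of \<partial>_x f, into (v,u,x), the
    layout of dom Y.\<close>
  let ?q = "\<lambda>p :: ('a \<times> 'b) \<times> 'a. (snd p, snd (fst p), fst (fst p))"
  have "closed (?q -` W)"
    by (intro closed_vimage W continuous_intros)
  moreover have "((xb, 0), 0) \<in> interior (?q -` W)"
  proof (rule interiorI)
    show "open (?q -` interior W)"
      by (intro open_vimage open_interior continuous_intros)
  qed (use W interior_subset in auto)
  moreover have "?q -` W \<inter> sv_gph (\<lambda>(x, u). subdiff_x f x u) = ?q -` (W \<inter> sv_dom (map_Y f))"
    using dom by (auto simp: sv_gph_def)
  then have "closed (?q -` W \<inter> sv_gph (\<lambda>(x, u). subdiff_x f x u))"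
    by (simp only:) (intro closed_vimage cl continuous_intros)
  ultimately have "prop_C f xb W"
    unfolding prop_C_def using cl dom by (auto simp: sv_dom_def map_Y_def)
  then show ?thesis
    unfolding prop_CD_def using W D by blast
qed

end

lemma composite_form_imp_composite:
  assumes "composite_form f f0 F g"
  obtains f0' F' where "composite f f0 F g f0' F'"
proof -
  have c: "twice_cont_diff f0" "twice_cont_diff F" "proper_fun g" "lower_semicont g" "convex_fun g"
    "\<And>x u. f (x, u) = ereal (f0 x) + g (F x + u)"
    using assms by (auto simp: composite_form_def)
  obtain f0' where "\<And>x. (f0 has_derivative f0' x) (at x)" "\<And>x k. isCont (\<lambda>x. f0' x k) x"
    by (rule twice_cont_diff_imp_C1[OF c(1)]) (rule that)
  moreover obtain F' where "\<And>x. (F has_derivative F' x) (at x)" "\<And>x k. isCont (\<lambda>x. F' x k) x"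
    by (rule twice_cont_diff_imp_C1[OF c(2)]) (rule that)
  ultimately have "composite f f0 F g f0' F'"
    using c by unfold_locales
  then show thesis
    by (rule that)
qed

lemma BQ_imp_qualification:
  fixes F :: "real^'n \<Rightarrow> real^'m"
  assumes BQ: "BQ F g xb" and F': "(F has_derivative F') (at xb)"
    and fin: "\<bar>g (F xb)\<bar> \<noteq> \<infinity>"
  shows "\<forall>y. (\<forall>k. y \<bullet> F' k = 0) \<and> (\<forall>(z, \<rho>)\<in>epi g. y \<bullet> (z - F xb) \<le> 0) \<longrightarrow> y = 0"
proof (intro allI impI, elim conjE)
  fix y assume k: "\<forall>k. y \<bullet> F' k = 0" and N: "\<forall>(z, \<rho>)\<in>epi g. y \<bullet> (z - F xb) \<le> 0"
  \<comment> \<open>Uniqueness of the derivative identifies the Jacobian matrix with F', so the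
    transposed equation in (BQ) becomes orthogonality to the range of F'.\<close>
  have "jacobian F (at xb) *v k = F' k" for k
    using has_derivative_unique[OF F'] jacobian_works[of F "at xb"] F'
    unfolding differentiable_def by metis
  then have "(transpose (jacobian F (at xb)) *v y) \<bullet> k = 0" for k
    by (simp add: dot_lmul_matrix k)
  then have "transpose (jacobian F (at xb)) *v y = 0"
    by (metis inner_eq_zero_iff)
  moreover have "y \<in> sing_subdiff g (F xb)"
    using fin by (rule conv_normal_imp_sing_subdiff) (use N in blast)
  ultimately show "y = 0"
    using BQ unfolding BQ_def by blast
qed

section \<open>Isolated calmness\<close>

lemma prop_C_mem_dom_Y:
  assumes "prop_C f xb W" and "(v, u, x) \<in> W"
  shows "v \<in> subdiff_x f x u \<longleftrightarrow> (v, u, x) \<in> sv_dom (map_Y f)"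
  using assms unfolding prop_C_def by fast

section \<open>Isolated calmness at the reference point\<close>

lemma calm_at_imp_directional:
  fixes f :: "'a::euclidean_space \<times> 'b::euclidean_space \<Rightarrow> ereal"
  assumes A: "prop_A f" and calm: "isolatedly_calm_at (map_M f) (0, 0) xb"
  shows "((0, 0), (dx, dy)) \<in> tangent_cone (sv_gph (map_M1 f)) ((0, 0), (xb, yb)) \<Longrightarrow> dx = 0"
    and "dx \<noteq> 0 \<Longrightarrow> inner_calm_star (map_Y f) (0, 0, xb) (0, 0, dx)"
proof -
  obtain \<kappa> where \<kappa>: "isolatedly_calm_const (map_M f) (0, 0) xb \<kappa>"
    using calm unfolding isolatedly_calm_at_def by blast
  \<comment> \<open>The tangent bound reads |dx| \<le> \<kappa> * 0. The same fact makes every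
    direction with dx \<noteq> 0 non-tangent, which settles inner calmness*.\<close>
  have *: "dx = 0" if "(0, 0, dx) \<in> tangent_cone (sv_dom (map_Y f)) (0, 0, xb)" for dx
    using isolatedly_calm_tangent_bound[OF A \<kappa> that] by (simp add: norm_Pair)
  show "dx = 0" if "((0, 0), (dx, dy)) \<in> tangent_cone (sv_gph (map_M1 f)) ((0, 0), (xb, yb))"
    using * tangent_cone_M1_imp_dom_Y[OF that] .
  show "inner_calm_star (map_Y f) (0, 0, xb) (0, 0, dx)" if "dx \<noteq> 0"
    using * that unfolding inner_calm_star_def by blast
qed

lemma directional_imp_calm_at:
  fixes f :: "'a::euclidean_space \<times> 'b::euclidean_space \<Rightarrow> ereal"
  assumes B: "prop_B f" and CD: "prop_CD f xb" and gph: "0 \<in> subdiff_x f xb 0"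
    and M1: "\<And>yb dx dy. yb \<in> Y_hat f xb \<Longrightarrow>
      ((0, 0), (dx, dy)) \<in> tangent_cone (sv_gph (map_M1 f)) ((0, 0), (xb, yb)) \<Longrightarrow> dx = 0"
    and Y: "\<And>dx. dx \<noteq> 0 \<Longrightarrow> inner_calm_star (map_Y f) (0, 0, xb) (0, 0, dx)"
  shows "isolatedly_calm_at (map_M f) (0, 0) xb"
proof (rule ccontr)
  assume ncalm: "\<not> ?thesis"
  obtain W where W: "(0, 0, xb) \<in> interior W" and C: "prop_C f xb W"
    using CD unfolding prop_CD_def by blast
  \<comment> \<open>Calmness fails for every constant; the choice \<kappa> = k + 1 forces (dv,du) to
    0 while dx stays on the unit sphere.\<close>
  have "\<exists>dv du dx. (dv, du, dx) \<in> tangent_cone (sv_dom (map_Y f)) (0, 0, xb) \<and>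
      norm dx = 1 \<and> norm (dv, du) \<le> 1 / real (Suc k)" for k
    by (rule not_isolatedly_calm_tangent[OF W _ gph, of "real (Suc k)"])
      (use ncalm prop_C_mem_dom_Y[OF C] in \<open>auto simp: isolatedly_calm_at_def\<close>)
  then obtain dv du dx where d: "\<And>k. (dv k, du k, dx k) \<in> tangent_cone (sv_dom (map_Y f)) (0, 0, xb)"
    and n: "\<And>k. norm (dx k) = 1" "\<And>k. norm (dv k, du k) \<le> 1 / real (Suc k)"
    by metis
  have "bounded (range dx)"
    by (rule boundedI[of _ 1]) (auto simp: n)
  then obtain r l where r: "strict_mono (r :: nat \<Rightarrow> nat)" and l: "(dx \<circ> r) \<longlonglongrightarrow> l"
    using bounded_imp_convergent_subsequence by blast
  have "(\<lambda>k. norm ((dx \<circ> r) k)) \<longlonglongrightarrow> norm l"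
    by (intro tendsto_norm l)
  then have "l \<noteq> 0"
    by (auto simp: n LIMSEQ_const_iff)
  have "(\<lambda>k. (dv k, du k)) \<longlonglongrightarrow> 0"
    by (rule Lim_null_comparison[OF _ LIMSEQ_inverse_real_of_nat])
      (use n in \<open>simp add: inverse_eq_divide del: of_nat_Suc\<close>)
  then have dvu: "(\<lambda>k. ((dv (r k), du (r k)))) \<longlonglongrightarrow> 0"
    using LIMSEQ_subseq_LIMSEQ[OF _ r] by (auto simp: o_def)
  have "(\<lambda>k. (dv (r k), du (r k), dx (r k))) \<longlonglongrightarrow> (0, 0, l)"
    using tendsto_fst[OF dvu] tendsto_snd[OF dvu] l by (auto simp: o_def intro!: tendsto_Pair)
  then have tan: "(0, 0, l) \<in> tangent_cone (sv_dom (map_Y f)) (0, 0, xb)"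
    by (rule closed_sequentially[OF closed_tangent_cone, rotated]) (rule d)
  then obtain \<kappa> where "inner_calm_star_const (map_Y f) (0, 0, xb) (0, 0, l) \<kappa>"
    using Y[OF \<open>l \<noteq> 0\<close>] unfolding inner_calm_star_def by blast
  then obtain y dy where "y \<in> map_Y f (0, 0, xb)"
    "((0, 0), (l, dy)) \<in> tangent_cone (sv_gph (map_M1 f)) ((0, 0), (xb, y))"
    using inner_calm_star_tangent_M1[OF B] by metis
  then show False
    using M1[of y l dy] \<open>l \<noteq> 0\<close> by (simp add: Y_hat_def)
qed

section \<open>Isolated calmness around the reference point\<close>

lemma calm_around_imp_tangent_bound:
  fixes f :: "'a::euclidean_space \<times> 'b::euclidean_space \<Rightarrow> ereal"
  assumes A: "prop_A f" and calm: "isolatedly_calm_around (map_M f) (0, 0) xb"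
  obtains U \<kappa> where "open U" and "(0, 0, xb) \<in> U" and "\<kappa> > 0"
    and "\<And>v u x dv du dx. (v, u, x) \<in> U \<Longrightarrow> (v, u, x) \<in> sv_dom (map_Y f) \<Longrightarrow>
      (dv, du, dx) \<in> tangent_cone (sv_dom (map_Y f)) (v, u, x) \<Longrightarrow>
      norm dx \<le> \<kappa> * norm (dv, du)"
proof -
  obtain \<kappa> W where "\<kappa> > 0" and W: "((0, 0), xb) \<in> interior W"
    and cW: "\<And>a' b'. (a', b') \<in> W \<inter> sv_gph (map_M f) \<Longrightarrow> isolatedly_calm_const (map_M f) a' b' \<kappa>"
    using calm unfolding isolatedly_calm_around_def by blast
  let ?p = "\<lambda>w :: 'a \<times> 'b \<times> 'a. ((fst w, fst (snd w)), snd (snd w))"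
  show thesis
  proof (rule that)
    show "open (?p -` interior W)"
      by (intro open_vimage continuous_intros) simp
    show "(0, 0, xb) \<in> ?p -` interior W"
      using W by simp
    fix v u x dv du dx
    assume 1: "(v, u, x) \<in> ?p -` interior W" and 2: "(v, u, x) \<in> sv_dom (map_Y f)"
      and 3: "(dv, du, dx) \<in> tangent_cone (sv_dom (map_Y f)) (v, u, x)"
    have "((v, u), x) \<in> W"
      using 1 interior_subset by auto
    moreover have "((v, u), x) \<in> sv_gph (map_M f)"
      using 2 A unfolding prop_A_def sv_gph_def map_M_def by auto
    ultimately show "norm dx \<le> \<kappa> * norm (dv, du)"
      using isolatedly_calm_tangent_bound[OF A cW 3] by blast
  qed (fact \<open>\<kappa> > 0\<close>)
qed

lemma calm_around_imp_limiting:
  fixes f :: "'a::euclidean_space \<times> 'b::euclidean_space \<Rightarrow> ereal"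
  assumes A: "prop_A f" and calm: "isolatedly_calm_around (map_M f) (0, 0) xb"
    and "((0, 0), (dx, dy)) \<in> limiting_tangent_cone (sv_gph (map_M1 f)) ((0, 0), (xb, yb))"
  shows "dx = 0"
proof -
  obtain U \<kappa> where U: "open U" "(0, 0, xb) \<in> U" and "\<kappa> > 0"
    and bd: "\<And>v u x dv du dx. (v, u, x) \<in> U \<Longrightarrow> (v, u, x) \<in> sv_dom (map_Y f) \<Longrightarrow>
      (dv, du, dx) \<in> tangent_cone (sv_dom (map_Y f)) (v, u, x) \<Longrightarrow>
      norm dx \<le> \<kappa> * norm (dv, du)"
    using calm_around_imp_tangent_bound[OF A calm] by blast
  obtain z d where z: "z \<longlonglongrightarrow> ((0, 0), (xb, yb))" and d: "d \<longlonglongrightarrow> ((0, 0), (dx, dy))"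
    and gph: "\<And>k::nat. z k \<in> sv_gph (map_M1 f)"
    and tan: "\<And>k. d k \<in> tangent_cone (sv_gph (map_M1 f)) (z k)"
    using assms(3) unfolding limiting_tangent_cone_def by blast
  let ?p = "\<lambda>z. (fst (fst z), snd (fst z), fst (snd z))"
  have "(\<lambda>k. ?p (z k)) \<longlonglongrightarrow> ?p ((0, 0), (xb, yb))"
    by (intro tendsto_intros z)
  then have "\<forall>\<^sub>F k in sequentially. ?p (z k) \<in> U"
    by (rule topological_tendstoD) (use U in auto)
  then have ev: "\<forall>\<^sub>F k in sequentially. norm (fst (snd (d k))) \<le> \<kappa> * norm (fst (d k))"
  proof eventually_elim
    case (elim k)
    obtain v u x y dv du dx dy where eq: "z k = ((v, u), (x, y))" "d k = ((dv, du), (dx, dy))"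
      by (metis prod.collapse)
    have "(v, u, x) \<in> sv_dom (map_Y f)"
      using gph[of k] unfolding eq sv_gph_def map_M1_def sv_dom_def map_Y_def by auto
    then show ?case
      using bd[of v u x] elim tangent_cone_M1_imp_dom_Y[OF tan[of k, unfolded eq]]
      unfolding eq by simp
  qed
  \<comment> \<open>A common \<kappa> at all nearby graph points is what lets the bound pass to the
    limit; there (dv,du) = 0.\<close>
  have "norm (fst (snd ((0::'a, 0::'b), (dx, dy)))) \<le> \<kappa> * norm (fst ((0::'a, 0::'b), (dx, dy)))"
    by (rule tendsto_le[OF sequentially_bot tendsto_mult_left[OF tendsto_norm[OF tendsto_fst[OF d]]]
        tendsto_norm[OF tendsto_fst[OF tendsto_snd[OF d]]] ev])
  then show ?thesis
    by (simp add: norm_Pair)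
qed

lemma calm_around_imp_inner_calm_star:
  fixes f :: "'a::euclidean_space \<times> 'b::euclidean_space \<Rightarrow> ereal"
  assumes A: "prop_A f" and calm: "isolatedly_calm_around (map_M f) (0, 0) xb" and "dx \<noteq> 0"
  shows "locally_uniformly_inner_calm_star (map_Y f) (0, 0, xb) (0, 0, dx)"
proof -
  obtain U \<kappa> where U: "open U" "(0, 0, xb) \<in> U" and "\<kappa> > 0"
    and bd: "\<And>v u x dv du dx. (v, u, x) \<in> U \<Longrightarrow> (v, u, x) \<in> sv_dom (map_Y f) \<Longrightarrow>
      (dv, du, dx) \<in> tangent_cone (sv_dom (map_Y f)) (v, u, x) \<Longrightarrow>
      norm dx \<le> \<kappa> * norm (dv, du)"
    using calm_around_imp_tangent_bound[OF A calm] by blast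
  \<comment> \<open>The open cone of directions that violate the tangent bound. None of them is
    tangent to dom Y at a point of U, so every modulus is 0 and the bound 1 will do.\<close>
  let ?N = "{d :: 'a \<times> 'b \<times> 'a. \<kappa> * norm (fst d, fst (snd d)) < norm (snd (snd d))}"
  have N: "open ?N"
    by (intro open_Collect_less continuous_intros)
  have "inner_calm_star (map_Y f) a d \<and> inner_calm_star_modulus (map_Y f) a d \<le> 1"
    if "a \<in> U \<inter> sv_dom (map_Y f)" "d \<in> ?N" for a d
  proof -
    have "d \<notin> tangent_cone (sv_dom (map_Y f)) a"
      using bd[of "fst a" "fst (snd a)" "snd (snd a)" "fst d" "fst (snd d)" "snd (snd d)"] that by auto
    then show ?thesis
      by (simp add: inner_calm_star_def inner_calm_star_modulus_def)
  qed
  moreover have "(0, 0, xb) \<in> interior U" and "(0, 0, dx) \<in> interior ?N"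
    unfolding interior_open[OF U(1)] interior_open[OF N]
    using U \<open>dx \<noteq> 0\<close> by (simp_all add: norm_Pair)
  ultimately show ?thesis
    unfolding locally_uniformly_inner_calm_star_def by (blast intro: zero_less_one)
qed

text \<open>The infimum defining the modulus need not be attained, so an admissible constant is
  available only below a strictly larger number.\<close>

lemma modulus_le_imp_const:
  assumes "inner_calm_star \<Upsilon> a d" and "inner_calm_star_modulus \<Upsilon> a d \<le> \<kappa>"
    and "d \<in> tangent_cone (sv_dom \<Upsilon>) a" and "\<kappa> < \<kappa>'"
  obtains l where "inner_calm_star_const \<Upsilon> a d l" and "l < \<kappa>'"
proof -
  let ?S = "{\<kappa>. inner_calm_star_const \<Upsilon> a d \<kappa>}"
  have "?S \<noteq> {}"
    using assms(1,3) by (auto simp: inner_calm_star_def)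
  moreover have "Inf ?S < \<kappa>'"
    using assms(2-4) by (simp add: inner_calm_star_modulus_def)
  ultimately obtain l where "l \<in> ?S" "l < \<kappa>'"
    by (meson cInf_lessD)
  then show thesis
    using that by blast
qed

text \<open>Base points now move, so the lifted tangents sit over different multipliers. The base
  multipliers are bounded by (D), their tangent components by the uniform modulus; a common
  subsequence gives an element of the limiting tangent cone, with (B) placing its base point in the
  graph.\<close>

lemma limiting_imp_calm_around:
  fixes f :: "'a::euclidean_space \<times> 'b::euclidean_space \<Rightarrow> ereal"
  assumes B: "prop_B f" and CD: "prop_CD f xb" and gph: "0 \<in> subdiff_x f xb 0"
    and M1: "\<And>yb dx dy. yb \<in> Y_hat f xb \<Longrightarrow>
      ((0, 0), (dx, dy)) \<in> limiting_tangent_cone (sv_gph (map_M1 f)) ((0, 0), (xb, yb)) \<Longrightarrow> dx = 0"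
    and Y: "\<And>dx. dx \<noteq> 0 \<Longrightarrow> locally_uniformly_inner_calm_star (map_Y f) (0, 0, xb) (0, 0, dx)"
  shows "isolatedly_calm_around (map_M f) (0, 0) xb"
proof (rule ccontr)
  assume ncalm: "\<not> ?thesis"
  obtain W where W: "(0, 0, xb) \<in> interior W" and C: "prop_C f xb W" and D: "prop_D f W"
    using CD unfolding prop_CD_def by blast
  let ?q = "\<lambda>w :: ('a \<times> 'b) \<times> 'a. (fst (fst w), snd (fst w), snd w)"
  have "\<exists>v u x. (v, u, x) \<in> interior W \<and> dist ((v, u), x) ((0, 0), xb) < inverse (real (Suc k)) \<and>
      v \<in> subdiff_x f x u \<and> \<not> isolatedly_calm_const (map_M f) (v, u) x (real (Suc k))" for k
  proof (rule ccontr)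
    \<comment> \<open>The ball makes the failing points converge to the reference point; the second
      set keeps them in the interior of W, where (C) applies.\<close>
    let ?V = "ball ((0, 0), xb) (inverse (real (Suc k))) \<inter> ?q -` interior W"
    assume "\<not> ?thesis"
    then have 1: "\<forall>(a', b') \<in> ?V \<inter> sv_gph (map_M f). isolatedly_calm_const (map_M f) a' b' (real (Suc k))"
      by (auto simp: sv_gph_def map_M_def dist_commute simp del: of_nat_Suc)
    have "open ?V"
      by (intro open_Int open_ball open_vimage continuous_intros open_interior)
    then have 2: "((0, 0), xb) \<in> interior ?V"
      unfolding interior_open[OF \<open>open ?V\<close>] using W by (simp del: of_nat_Suc)
    have 3: "((0, 0), xb) \<in> sv_gph (map_M f)"
      using gph by (simp add: sv_gph_def map_M_def)
    have "isolatedly_calm_around (map_M f) (0, 0) xb"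
      unfolding isolatedly_calm_around_def
      by (intro conjI exI[of _ "real (Suc k)"] exI[of _ ?V] 1 2 3) simp
    with ncalm show False ..
  qed
  then obtain v u x where w: "\<And>k. (v k, u k, x k) \<in> interior W"
    and dist: "\<And>k. dist ((v k, u k), x k) ((0, 0), xb) < inverse (real (Suc k))"
    and sub: "\<And>k. v k \<in> subdiff_x f (x k) (u k)"
    and nc: "\<And>k. \<not> isolatedly_calm_const (map_M f) (v k, u k) (x k) (real (Suc k))"
    by metis
  define a where "a k = (v k, u k, x k)" for k
  have adom: "a k \<in> sv_dom (map_Y f)" for k
    using prop_C_mem_dom_Y[OF C] sub[of k] w[of k] interior_subset unfolding a_def by blast
  have vux: "(\<lambda>k. ((v k, u k), x k)) \<longlonglongrightarrow> ((0, 0), xb)"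
    using dist by (rule tendsto_inverse_Suc)
  have alim: "a \<longlonglongrightarrow> (0, 0, xb)"
    using tendsto_fst[OF tendsto_fst[OF vux]] tendsto_snd[OF tendsto_fst[OF vux]] tendsto_snd[OF vux]
    unfolding a_def[abs_def] by (auto intro!: tendsto_Pair)
  have "\<exists>dv du dx. (dv, du, dx) \<in> tangent_cone (sv_dom (map_Y f)) (a k) \<and>
      norm dx = 1 \<and> norm (dv, du) \<le> 1 / real (Suc k)" for k
    unfolding a_def
    by (rule not_isolatedly_calm_tangent[OF w[of k] _ sub[of k] _ nc[of k]])
      (use prop_C_mem_dom_Y[OF C] in auto)
  then obtain dv du dx where d: "\<And>k. (dv k, du k, dx k) \<in> tangent_cone (sv_dom (map_Y f)) (a k)"
    and n: "\<And>k. norm (dx k) = 1" "\<And>k. norm (dv k, du k) \<le> 1 / real (Suc k)"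
    by metis
  have "bounded (range dx)"
    by (rule boundedI[of _ 1]) (auto simp: n)
  then obtain r l where r: "strict_mono (r :: nat \<Rightarrow> nat)" and l: "(dx \<circ> r) \<longlonglongrightarrow> l"
    using bounded_imp_convergent_subsequence by blast
  have "(\<lambda>k. norm ((dx \<circ> r) k)) \<longlonglongrightarrow> norm l"
    by (intro tendsto_norm l)
  then have "l \<noteq> 0"
    by (auto simp: n LIMSEQ_const_iff)
  have "(\<lambda>k. (dv k, du k)) \<longlonglongrightarrow> 0"
    by (rule Lim_null_comparison[OF _ LIMSEQ_inverse_real_of_nat])
      (use n in \<open>simp add: inverse_eq_divide del: of_nat_Suc\<close>)
  then have dvu: "(\<lambda>k. ((dv (r k), du (r k)))) \<longlonglongrightarrow> 0"
    using LIMSEQ_subseq_LIMSEQ[OF _ r] by (auto simp: o_def)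
  have dlim: "(\<lambda>k. (dv (r k), du (r k), dx (r k))) \<longlonglongrightarrow> (0, 0, l)"
    using tendsto_fst[OF dvu] tendsto_snd[OF dvu] l by (auto simp: o_def intro!: tendsto_Pair)
  have arlim: "(\<lambda>k. a (r k)) \<longlonglongrightarrow> (0, 0, xb)"
    using LIMSEQ_subseq_LIMSEQ[OF alim r] by (simp add: o_def)
  \<comment> \<open>Local uniformity depends on the direction, so it is invoked at l only after the
    subsequence has been chosen; from some index on, base points and directions lie in U and
    N.\<close>
  obtain U N \<kappa> where U: "(0, 0, xb) \<in> interior U" and N: "(0, 0, l) \<in> interior N" and "\<kappa> > 0"
    and calm: "\<And>a' d'. a' \<in> U \<inter> sv_dom (map_Y f) \<Longrightarrow> d' \<in> N \<Longrightarrow>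
      inner_calm_star (map_Y f) a' d' \<and> inner_calm_star_modulus (map_Y f) a' d' \<le> \<kappa>"
    using Y[OF \<open>l \<noteq> 0\<close>] unfolding locally_uniformly_inner_calm_star_def by blast
  have "\<forall>\<^sub>F k in sequentially. a (r k) \<in> interior U \<and> (dv (r k), du (r k), dx (r k)) \<in> interior N"
    using U N by (intro eventually_conj topological_tendstoD[OF arlim] topological_tendstoD[OF dlim]) auto
  then obtain K where K: "\<And>k. k \<ge> K \<Longrightarrow> a (r k) \<in> U \<and> (dv (r k), du (r k), dx (r k)) \<in> N"
    unfolding eventually_sequentially using interior_subset by blast
  have "\<exists>y dy. y \<in> map_Y f (a (r (k + K))) \<and> norm dy \<le> (\<kappa> + 1) * norm (dv (r (k + K)), du (r (k + K)), dx (r (k + K))) \<and>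
      ((dv (r (k + K)), du (r (k + K))), (dx (r (k + K)), dy)) \<in> tangent_cone (sv_gph (map_M1 f))
        ((v (r (k + K)), u (r (k + K))), (x (r (k + K)), y))" for k
  proof -
    let ?j = "r (k + K)"
    have "inner_calm_star (map_Y f) (a ?j) (dv ?j, du ?j, dx ?j)"
      "inner_calm_star_modulus (map_Y f) (a ?j) (dv ?j, du ?j, dx ?j) \<le> \<kappa>"
      using calm[of "a ?j" "(dv ?j, du ?j, dx ?j)"] K[of "k + K"] adom[of ?j] by auto
    \<comment> \<open>Passing from \<kappa> to \<kappa> + 1 compensates for a modulus that may not
      be attained, with a bound common to all indices.\<close>
    then obtain l where l: "inner_calm_star_const (map_Y f) (a ?j) (dv ?j, du ?j, dx ?j) l" "l < \<kappa> + 1"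
      using modulus_le_imp_const[OF _ _ d, of ?j \<kappa> "\<kappa> + 1"] by auto
    obtain y dy where "y \<in> map_Y f (a ?j)" "norm dy \<le> l * norm (dv ?j, du ?j, dx ?j)"
      "((dv ?j, du ?j), (dx ?j, dy)) \<in> tangent_cone (sv_gph (map_M1 f)) ((v ?j, u ?j), (x ?j, y))"
      using inner_calm_star_tangent_M1[OF B l(1)[unfolded a_def]] unfolding a_def by blast
    moreover have "l * norm (dv ?j, du ?j, dx ?j) \<le> (\<kappa> + 1) * norm (dv ?j, du ?j, dx ?j)"
      using l(2) by (intro mult_right_mono) auto
    ultimately show ?thesis
      using order_trans by blast
  qed
  then obtain y dy where y: "\<And>k. y k \<in> map_Y f (a (r (k + K)))"
    and dy: "\<And>k. norm (dy k) \<le> (\<kappa> + 1) * norm (dv (r (k + K)), du (r (k + K)), dx (r (k + K)))"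
    and tan: "\<And>k. ((dv (r (k + K)), du (r (k + K))), (dx (r (k + K)), dy k)) \<in> tangent_cone (sv_gph (map_M1 f))
        ((v (r (k + K)), u (r (k + K))), (x (r (k + K)), y k))"
    by metis
  have "bounded (range y)"
    using D unfolding prop_D_def
    by (rule bounded_subset) (use y w interior_subset in \<open>fastforce simp: a_def\<close>)
  \<comment> \<open>The factor 3 bounds |dv| + |du| + |dx|, each summand being at most 1.\<close>
  moreover have "norm (dy k) \<le> (\<kappa> + 1) * 3" for k
  proof -
    let ?j = "r (k + K)"
    have "norm (dv ?j, du ?j) \<le> 1"
      using n(2)[of ?j] by (rule order_trans) simp
    then have "norm (dv ?j, du ?j, dx ?j) \<le> 3"
      using norm_Pair_le[of "dv ?j" "(du ?j, dx ?j)"] norm_Pair_le[of "du ?j" "dx ?j"] n(1)[of ?j]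
        norm_fst_le[of "dv ?j" "du ?j"] norm_snd_le[of "du ?j" "dv ?j"] by linarith
    then show ?thesis
      using dy[of k] \<open>\<kappa> > 0\<close> by (meson add_pos_pos less_imp_le mult_left_mono order_trans zero_less_one)
  qed
  then have "bounded (range dy)"
    by (auto intro!: boundedI)
  ultimately have "bounded (range (\<lambda>k. (y k, dy k)))"
    by (rule bounded_subset[OF bounded_Times]) auto
  then obtain s p where s: "strict_mono (s :: nat \<Rightarrow> nat)" and p: "((\<lambda>k. (y k, dy k)) \<circ> s) \<longlonglongrightarrow> p"
    using bounded_imp_convergent_subsequence by blast
  have ys: "(\<lambda>k. y (s k)) \<longlonglongrightarrow> fst p" and dys: "(\<lambda>k. dy (s k)) \<longlonglongrightarrow> snd p"
    using tendsto_fst[OF p] tendsto_snd[OF p] by (simp_all add: o_def)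
  have als: "(\<lambda>k. a (r (s k + K))) \<longlonglongrightarrow> (0, 0, xb)"
    using LIMSEQ_subseq_LIMSEQ[OF LIMSEQ_ignore_initial_segment[OF arlim, of K] s] by (simp add: o_def)
  have dls: "(\<lambda>k. (dv (r (s k + K)), du (r (s k + K)), dx (r (s k + K)))) \<longlonglongrightarrow> (0, 0, l)"
    using LIMSEQ_subseq_LIMSEQ[OF LIMSEQ_ignore_initial_segment[OF dlim, of K] s] by (simp add: o_def)
  have "(\<lambda>k. (a (r (s k + K)), y (s k))) \<longlonglongrightarrow> ((0, 0, xb), fst p)"
    by (intro tendsto_Pair als ys)
  then have "((0, 0, xb), fst p) \<in> sv_gph (map_Y f)"
    by (rule closed_sequentially[OF B[unfolded prop_B_def], rotated]) (simp add: sv_gph_def y)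
  then have yb: "fst p \<in> Y_hat f xb"
    by (simp add: sv_gph_def Y_hat_def)
  have "((0, 0), (l, snd p)) \<in> limiting_tangent_cone (sv_gph (map_M1 f)) ((0, 0), (xb, fst p))"
    unfolding limiting_tangent_cone_def
  proof (intro CollectI exI conjI allI)
    let ?j = "\<lambda>k. r (s k + K)"
    show "(\<lambda>k. ((v (?j k), u (?j k)), (x (?j k), y (s k)))) \<longlonglongrightarrow> ((0, 0), (xb, fst p))"
      using tendsto_fst[OF als] tendsto_snd[OF als] ys tendsto_fst[OF tendsto_snd[OF als]]
        tendsto_snd[OF tendsto_snd[OF als]]
      by (intro tendsto_Pair) (simp_all add: a_def)
    show "(\<lambda>k. ((dv (?j k), du (?j k)), (dx (?j k), dy (s k)))) \<longlonglongrightarrow> ((0, 0), (l, snd p))"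
      using tendsto_fst[OF dls] tendsto_fst[OF tendsto_snd[OF dls]]
        tendsto_snd[OF tendsto_snd[OF dls]] dys
      by (intro tendsto_Pair) simp_all
    fix k
    show "((v (?j k), u (?j k)), (x (?j k), y (s k))) \<in> sv_gph (map_M1 f)"
      using y[of "s k"] by (simp add: a_def sv_gph_def map_M1_def map_Y_def)
    show "((dv (?j k), du (?j k)), (dx (?j k), dy (s k))) \<in> tangent_cone (sv_gph (map_M1 f))
        ((v (?j k), u (?j k)), (x (?j k), y (s k)))"
      by (rule tan)
  qed
  then show False
    using M1[OF yb] \<open>l \<noteq> 0\<close> by blast
qed

theorem theorem3p10:
  fixes f :: "(real^'n) \<times> (real^'m) \<Rightarrow> ereal" and xb :: "real^'n"
  assumes "proper_fun f" and "lower_semicont f" and "0 \<in> subdiff_x f xb 0"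
  shows
    "(\<forall>f0 F g. composite_form f f0 F g \<longrightarrow> prop_A f \<and> prop_B f) \<and>
     (\<forall>f0 F g. composite_form f f0 F g \<and> BQ F g xb \<longrightarrow> prop_CD f xb) \<and>
     (prop_A f \<and> prop_B f \<longrightarrow>
        (isolatedly_calm_at (map_M f) (0, 0) xb \<longrightarrow>
           (\<forall>yb\<in>Y_hat f xb. \<forall>dx dy.
              ((0, 0), (dx, dy)) \<in> tangent_cone (sv_gph (map_M1 f)) ((0, 0), (xb, yb)) \<longrightarrow> dx = 0) \<and>
           (\<forall>dx. dx \<noteq> 0 \<longrightarrow> inner_calm_star (map_Y f) (0, 0, xb) (0, 0, dx))) \<and>
        (prop_CD f xb \<longrightarrow>
           (\<forall>yb\<in>Y_hat f xb. \<forall>dx dy.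
              ((0, 0), (dx, dy)) \<in> tangent_cone (sv_gph (map_M1 f)) ((0, 0), (xb, yb)) \<longrightarrow> dx = 0) \<and>
           (\<forall>dx. dx \<noteq> 0 \<longrightarrow> inner_calm_star (map_Y f) (0, 0, xb) (0, 0, dx)) \<longrightarrow>
           isolatedly_calm_at (map_M f) (0, 0) xb) \<and>
        (isolatedly_calm_around (map_M f) (0, 0) xb \<longrightarrow>
           (\<forall>yb\<in>Y_hat f xb. \<forall>dx dy.
              ((0, 0), (dx, dy)) \<in> limiting_tangent_cone (sv_gph (map_M1 f)) ((0, 0), (xb, yb)) \<longrightarrow>
              dx = 0) \<and>
           (\<forall>dx. dx \<noteq> 0 \<longrightarrow>
              locally_uniformly_inner_calm_star (map_Y f) (0, 0, xb) (0, 0, dx))) \<and>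
        (prop_CD f xb \<longrightarrow>
           (\<forall>yb\<in>Y_hat f xb. \<forall>dx dy.
              ((0, 0), (dx, dy)) \<in> limiting_tangent_cone (sv_gph (map_M1 f)) ((0, 0), (xb, yb)) \<longrightarrow>
              dx = 0) \<and>
           (\<forall>dx. dx \<noteq> 0 \<longrightarrow>
              locally_uniformly_inner_calm_star (map_Y f) (0, 0, xb) (0, 0, dx)) \<longrightarrow>
           isolatedly_calm_around (map_M f) (0, 0) xb))"
proof (intro conjI allI impI; (elim conjE)?)
  fix f0 F and g :: "real^'m \<Rightarrow> ereal"
  assume "composite_form f f0 F g"
  then obtain f0' F' where "composite f f0 F g f0' F'"
    by (rule composite_form_imp_composite)
  then interpret composite f f0 F g f0' F' .
  show "prop_A f" and "prop_B f"
    by (fact prop_A prop_B)+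
next
  fix f0 F and g :: "real^'m \<Rightarrow> ereal"
  assume "composite_form f f0 F g" and BQ: "BQ F g xb"
  then obtain f0' F' where "composite f f0 F g f0' F'"
    using composite_form_imp_composite by blast
  then interpret composite f f0 F g f0' F' .
  \<comment> \<open>A nonempty subdifferential presupposes a finite value; this makes g finite at
    F(xb), as the singular subdifferential in (BQ) requires.\<close>
  have "\<bar>f (xb, 0)\<bar> \<noteq> \<infinity>"
    using assms(3) by (simp add: subdiff_x_def lim_subdiff_def)
  then have fin: "\<bar>g (F xb)\<bar> \<noteq> \<infinity>"
    using f[of xb 0] by (cases "g (F xb)") auto
  show "prop_CD f xb"
    by (rule prop_CD[OF fin BQ_imp_qualification[OF BQ F' fin]])
qed (use calm_at_imp_directional directional_imp_calm_at[OF _ _ assms(3)] calm_around_imp_limiting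
    calm_around_imp_inner_calm_star limiting_imp_calm_around[OF _ _ assms(3)] in blast)+

end
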